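(* Let $t \ge 0$ be a real number and let $G$ be a $t$-tough graph on $n \ge 3$ vertices. If $\sigma_2(G) > \frac{2n}{t+1} + t - 2$, then $G$ is hamiltonian.
   Context: All graphs are finite and simple. For a graph $G$, $c(G)$ denotes the number of components of $G$. A graph $G$ is $t$-tough if $|S| \ge t\cdot c(G-S)$ for every $S \subseteq V(G)$ with $c(G-S)\ge 2$. $\sigma_2(G)=\min\{d_G(u)+d_G(v) : u,v\in V(G),\ u \text{ and } v \text{ nonadjacent}\}$ if $G$ is not complete, and $\sigma_2(G)=\infty$ if $G$ is complete. A graph is hamiltonian if it has a cycle containing all its vertices. *)

theory Defs
  imports
    "HOL-Library.Extended_Real"
    "Graph_Theory.Graph_Theory"
begin

text \<open>
  A finite simple graph is an instance of the locale \<^locale>\<open>graph\<close>: a finite symmetric digraph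
  without loops and parallel arcs, in which an edge is a pair of opposite arcs.  Hence the degree of
  a vertex is its out-degree, and \<^const>\<open>arcs_ends\<close> is the adjacency relation.
\<close>

definition graph_components :: "('a, 'b) pre_digraph \<Rightarrow> ('a, 'b) pre_digraph set" where
  "graph_components G = {H. pre_digraph.max_subgraph G connected H}"

text \<open>On graphs these are the library's strongly connected components.\<close>

lemma graph_components_eq_sccs:
  assumes "sym_digraph G"
  shows "graph_components G = pre_digraph.sccs G"
proof -
  interpret sym_digraph G by fact
  have mono: "connected H2" if "connected H1" "subgraph H1 H2" "verts H1 = verts H2"
    for H1 H2 :: "('a, 'b) pre_digraph"
  proof -
    interpret H2: wf_digraph H2 using that by (simp add: subgraph_def)
    show ?thesis
      using that by (intro H2.connected_spanning_imp_connected[of H1]) (simp_all add: spanning_def)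
  qed
  have strong: "strongly_connected H" if "induced_subgraph H G" "connected H" for H
    using that induced_graph_imp_symmetric[OF sym_arcs that(1)]
    by (meson induced_imp_subgraph subgraph_def wf_digraph.symmetric_connected_imp_strongly_connected)
  have weak: "connected H" if "strongly_connected H" "wf_digraph H" for H :: "('a, 'b) pre_digraph"
  proof -
    interpret H: wf_digraph H by fact
    have "(u, v) \<in> rtrancl_on (verts H) ((arcs_ends H)\<^sup>s)" if "u \<rightarrow>\<^sup>*\<^bsub>H\<^esub> v" for u v
      using that unfolding reachable_def
      by (rule rtrancl_on_mono[rotated 2]) (auto simp: symcl_def)
    with \<open>strongly_connected H\<close> show ?thesis
      by (auto simp: connected_conv strongly_connected_def)
  qed
  have "max_subgraph connected H \<longleftrightarrow> max_subgraph strongly_connected H" for H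
  proof
    assume H: "max_subgraph connected H"
    have "induced_subgraph H G"
      using induced_subgraphI_arc_mono[OF H] mono unfolding arc_mono_def by blast
    with H show "max_subgraph strongly_connected H"
      using strong weak unfolding max_subgraph_def subgraph_def by blast
  next
    assume H: "max_subgraph strongly_connected H"
    have "\<not> connected K" if K: "H \<noteq> K" "subgraph H K" "subgraph K G" for K
    proof
      assume "connected K"
      let ?K = "G \<restriction> verts K"
      have sub: "subgraph K ?K" and ind: "induced_subgraph ?K G"
        using K(3) subgraph_induce_subgraphI2 induced_induce subgraph_imp_subverts by blast+
      then have "strongly_connected ?K"
        using mono[OF \<open>connected K\<close>] strong by simp
      moreover have "subgraph H ?K"
        using subgraph_trans K(2) sub by blast
      moreover have "H \<noteq> ?K"
        using K(1,2) sub unfolding subgraph_def compatible_def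
        by (metis pre_digraph.equality subset_antisym old.unit.exhaust)
      ultimately show False
        using H induced_imp_subgraph[OF ind] unfolding max_subgraph_def by metis
    qed
    moreover have "subgraph H G" "strongly_connected H"
      using H by (simp_all add: max_subgraph_def)
    ultimately show "max_subgraph connected H"
      using weak by (intro max_subgraphI) (auto simp: subgraph_def)
  qed
  then show ?thesis
    by (simp add: graph_components_def sccs_altdef2)
qed

definition tough :: "real \<Rightarrow> ('a, 'b) pre_digraph \<Rightarrow> bool" where
  "tough t G \<longleftrightarrow>
    (\<forall>S \<subseteq> verts G. card (graph_components (G \<restriction> (verts G - S))) \<ge> 2 \<longrightarrow>
      real (card S) \<ge> t * real (card (graph_components (G \<restriction> (verts G - S)))))"

definition sigma2 :: "('a, 'b) pre_digraph \<Rightarrow> ereal" where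
  "sigma2 G =
    (if complete_digraph (card (verts G)) G then \<infinity>
     else ereal (real (Min {out_degree G u + out_degree G v | u v.
       u \<in> verts G \<and> v \<in> verts G \<and> u \<noteq> v \<and> (u, v) \<notin> arcs_ends G})))"

text \<open>
  The library's cycles include the closed walks \<open>u, v, u\<close> along an edge and its reverse, which are
  not cycles of an undirected graph; the bound on the length excludes them.
\<close>

definition hamiltonian :: "('a, 'b) pre_digraph \<Rightarrow> bool" where
  "hamiltonian G \<longleftrightarrow>
    (\<exists>p. pre_digraph.cycle G p \<and> length p \<ge> 3 \<and> tail G ` set p = verts G)"

end

theory Submission
  imports Defs
begin

text \<open>
  For \<open>t < 1\<close> the degree condition is Ore's condition, which makes the graph 1-tough, so let
  \<open>t \<ge> 1\<close>.  Among all cycles choose \<open>C\<close> such that the largest component \<open>H\<close> of \<open>G - C\<close> is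
  as small as possible, there are few components of this size, and \<open>C\<close> cannot be extended.
  Let \<open>H\<close> have \<open>h\<close> vertices and \<open>m\<close> neighbours on \<open>C\<close>.  Behind each of these neighbours starts a
  connected set of at least \<open>h\<close> vertices, and these sets and \<open>H\<close> are pairwise separated, so toughness
  gives \<open>(t + h)(m + 1) \<le> n\<close>.  A vertex outside a cycle that cannot be inserted into it has few
  neighbours on it, as the successors of these neighbours are separated from each other.  With the
  degree condition this shows that \<open>H\<close> is the only component.  Now replace a shortest segment of
  \<open>C\<close> between neighbours of \<open>H\<close> by a path through \<open>H\<close>.  The vertices of the segment are not
  adjacent to \<open>H\<close>, whose vertices have low degree, so they have high degree and can be inserted
  again one after the other, which extends \<open>C\<close>.
\<close>

section \<open>Connectivity and cycles\<close>

lemma mod_add_cancel_nat: "(c + a) mod L = (c + b) mod L \<longleftrightarrow> a mod L = b mod L" for a b c L :: nat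
  unfolding nat_mod_eq_iff by simp

lemma mod_eq_window: "a = b" if "a mod L = b mod L" "i \<le> a" "a < i + L" "i \<le> b" "b < i + L"
  for a b i L :: nat
proof -
  have "(i + (a - i)) mod L = (i + (b - i)) mod L" using that by simp
  then have "(a - i) mod L = (b - i) mod L" unfolding mod_add_cancel_nat .
  moreover have "a - i < L" "b - i < L" using that by auto
  ultimately show ?thesis using that by simp
qed

locale simple_graph =
  fixes V :: "'a set" and adj :: "'a \<Rightarrow> 'a \<Rightarrow> bool"
  assumes finite_V: "finite V"
    and adj_sym: "adj u v \<Longrightarrow> adj v u"
    and adj_irrefl: "\<not> adj u u"
    and adj_V: "adj u v \<Longrightarrow> u \<in> V"
begin

section \<open>Connectivity inside a vertex set\<close>

definition conn :: "'a set \<Rightarrow> 'a \<Rightarrow> 'a \<Rightarrow> bool" where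
  "conn U u v \<longleftrightarrow> (u, v) \<in> rtrancl_on U {(a, b). adj a b}"

definition comp :: "'a set \<Rightarrow> 'a \<Rightarrow> 'a set" where
  "comp U u = {v. conn U u v}"

text \<open>\<open>U\<close> will be the complement of a cycle and the ends \<open>a\<close>,
  \<open>b\<close> vertices on it, so only the inner vertices of the connecting path are required to
  lie in \<open>U\<close>.\<close>

definition lnk :: "'a set \<Rightarrow> 'a \<Rightarrow> 'a \<Rightarrow> bool" where
  "lnk U a b \<longleftrightarrow> adj a b \<or> (\<exists>c d. adj a c \<and> conn U c d \<and> adj d b)"

definition cyc :: "'a list \<Rightarrow> bool" where
  "cyc c \<longleftrightarrow> 3 \<le> length c \<and> distinct c \<and> successively adj c \<and> adj (last c) (hd c)"

definition deg :: "'a \<Rightarrow> nat" where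
  "deg v = card {w. adj v w}"

lemma conn_in: "conn U u v \<Longrightarrow> u \<in> U" "conn U u v \<Longrightarrow> v \<in> U"
  by (auto simp: conn_def dest: in_rtrancl_on_in_F)

lemma conn_refl: "u \<in> U \<Longrightarrow> conn U u u"
  by (simp add: conn_def)

lemma conn_trans: "conn U u v \<Longrightarrow> conn U v w \<Longrightarrow> conn U u w"
  by (auto simp: conn_def intro: rtrancl_on_trans)

lemma conn_step: "conn U u v \<Longrightarrow> adj v w \<Longrightarrow> w \<in> U \<Longrightarrow> conn U u w"
  by (auto simp: conn_def intro: rtrancl_on_into_rtrancl_on)

lemma conn_sym: "conn U u v \<Longrightarrow> conn U v u"
proof -
  have "sym {(a, b). adj a b}"
    by (auto intro: symI adj_sym)
  then show "conn U u v \<Longrightarrow> conn U v u"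
    unfolding conn_def by (meson rtrancl_on_sym symE)
qed

lemma conn_mono: "conn U u v \<Longrightarrow> U \<subseteq> U' \<Longrightarrow> conn U' u v"
  unfolding conn_def by (rule rtrancl_on_mono) auto

lemma conn_induct [consumes 1, case_names base step]:
  assumes "conn U u v" "u \<in> U \<Longrightarrow> P u"
    "\<And>v w. conn U u v \<Longrightarrow> adj v w \<Longrightarrow> w \<in> U \<Longrightarrow> P v \<Longrightarrow> P w"
  shows "P v"
  using assms(1)[unfolded conn_def]
  by (induction rule: rtrancl_on_induct) (auto intro: assms(2,3) simp: conn_def)

lemma comp_subset: "comp U u \<subseteq> U"
  by (auto simp: comp_def dest: conn_in)

lemma comp_eq: "conn U u v \<Longrightarrow> comp U u = comp U v"
  by (auto simp: comp_def intro: conn_trans conn_sym)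

lemma comp_mono: "U \<subseteq> U' \<Longrightarrow> comp U u \<subseteq> comp U' u"
  by (auto simp: comp_def intro: conn_mono)

lemma mem_comp_self: "u \<in> U \<Longrightarrow> u \<in> comp U u"
  by (simp add: comp_def conn_refl)

lemma conn_comp:
  assumes "conn U u v"
  shows "conn (comp U u) u v"
  using assms
proof (induction rule: conn_induct)
  case base
  then show ?case by (simp add: conn_refl mem_comp_self)
next
  case (step v w)
  then show ?case by (auto simp: comp_def intro: conn_step)
qed

lemma finite_nbrs: "finite {w. adj v w}"
  by (rule finite_subset[OF _ finite_V]) (auto dest: adj_V adj_sym)

lemma conn_path:
  assumes "conn U u v"
  obtains p where "p \<noteq> []" "distinct p" "set p \<subseteq> comp U u" "hd p = u" "last p = v"
    "successively adj p"
proof -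
  have "\<exists>p. p \<noteq> [] \<and> distinct p \<and> set p \<subseteq> comp U u \<and> hd p = u \<and> last p = v \<and> successively adj p"
    using assms
  proof (induction rule: conn_induct)
    case base
    then show ?case by (intro exI[of _ "[u]"]) (simp add: mem_comp_self)
  next
    case (step v w)
    then obtain p where p: "p \<noteq> []" "distinct p" "set p \<subseteq> comp U u" "hd p = u" "last p = v"
      "successively adj p" by blast
    have w: "w \<in> comp U u"
      using step by (auto simp: comp_def intro: conn_step)
    show ?case
    proof (cases "w \<in> set p")
      case True
      then obtain q r where "p = q @ w # r"
        by (meson split_list)
      with p have "distinct (q @ [w])" "set (q @ [w]) \<subseteq> comp U u" "hd (q @ [w]) = u"
        "successively adj (q @ [w])"
        by (auto simp: successively_append_iff hd_append split: if_splits)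
      then show ?thesis by (intro exI[of _ "q @ [w]"]) simp
    next
      case False
      with p w step show ?thesis
        by (intro exI[of _ "p @ [w]"]) (auto simp: successively_append_iff)
    qed
  qed
  then show ?thesis using that by blast
qed

text \<open>The last clause locates the inner vertices: it is used to keep the path out of
  \<open>H\<close>, or away from \<open>y\<close>, when \<open>a\<close> has no neighbour in that
  component.\<close>

lemma lnk_path:
  assumes "lnk U a b"
  obtains Q where "distinct Q" "set Q \<subseteq> U" "successively adj (a # Q @ [b])"
    "\<And>q. q \<in> set Q \<Longrightarrow> \<exists>c. adj a c \<and> conn U c q"
proof (cases "adj a b")
  case True
  then show ?thesis using that[of "[]"] by simp
next
  case False
  then obtain c d where cd: "adj a c" "conn U c d" "adj d b"
    using assms by (auto simp: lnk_def)
  obtain p where p: "p \<noteq> []" "distinct p" "set p \<subseteq> comp U c" "hd p = c" "last p = d"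
    "successively adj p"
    using conn_path[OF cd(2)] by blast
  have "successively adj (a # p @ [b])"
    using p cd by (auto simp: successively_append_iff successively_Cons)
  moreover have "\<exists>c. adj a c \<and> conn U c q" if "q \<in> set p" for q
    using that p cd by (auto simp: comp_def)
  ultimately show ?thesis
    using that[of p] p comp_subset by blast
qed

lemma lnk_sym: "lnk U a b \<Longrightarrow> lnk U b a"
  unfolding lnk_def by (blast intro: adj_sym conn_sym)

text \<open>A walk in \<open>X \<union> U\<close> returns to \<open>X\<close> only along an edge or
  after an excursion through \<open>U\<close>, so consecutive visits are linked and carry equal
  labels; an excursion is traced to the vertex of \<open>X\<close> it left.\<close>

lemma conn_label:
  assumes "conn (X \<union> U) a v" "a \<in> X" "X \<inter> U = {}"
    and nolnk: "\<And>x y. x \<in> X \<Longrightarrow> y \<in> X \<Longrightarrow> l x \<noteq> l y \<Longrightarrow> \<not> lnk U x y"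
  shows "conn ({x \<in> X. l x = l a} \<union> U) a v"
    and "v \<in> X \<Longrightarrow> l v = l a"
    and "v \<in> U \<Longrightarrow> \<exists>x \<in> X. l x = l a \<and> (\<exists>c. adj x c \<and> conn U c v)"
proof -
  let ?Y = "{x \<in> X. l x = l a} \<union> U"
  have "conn ?Y a v \<and> (v \<in> X \<longrightarrow> l v = l a) \<and>
    (v \<in> U \<longrightarrow> (\<exists>x \<in> X. l x = l a \<and> (\<exists>c. adj x c \<and> conn U c v)))"
    using assms(1)
  proof (induction rule: conn_induct)
    case base
    then show ?case using assms(2,3) by (auto intro: conn_refl)
  next
    case (step v w)
    have v: "v \<in> X \<union> U" using step(1) by (rule conn_in)
    show ?case
    proof (cases "w \<in> X")
      case True
      have "l w = l a"
      proof (cases "v \<in> X")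
        case True
        with step have "lnk U v w" "l v = l a" by (auto simp: lnk_def)
        with nolnk[OF True \<open>w \<in> X\<close>] show ?thesis by metis
      next
        case False
        with v step obtain x c where "x \<in> X" "l x = l a" "adj x c" "conn U c v" by blast
        with step have "lnk U x w" by (auto simp: lnk_def)
        with nolnk[OF \<open>x \<in> X\<close> \<open>w \<in> X\<close>] \<open>l x = l a\<close> show ?thesis by metis
      qed
      with True step show ?thesis
        using assms(3) by (auto intro: conn_step)
    next
      case False
      with step have w: "w \<in> U" by auto
      have "\<exists>x \<in> X. l x = l a \<and> (\<exists>c. adj x c \<and> conn U c w)"
      proof (cases "v \<in> X")
        case True
        with step w show ?thesis by (auto intro: conn_refl)
      next
        case False
        with v step w show ?thesis by (blast intro: conn_step)
      qed
      with w False step show ?thesis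
        by (auto intro: conn_step)
    qed
  qed
  then show "conn ?Y a v" "v \<in> X \<Longrightarrow> l v = l a"
    "v \<in> U \<Longrightarrow> \<exists>x \<in> X. l x = l a \<and> (\<exists>c. adj x c \<and> conn U c v)"
    by auto
qed

text \<open>The standard exchange on a cycle: \<^term>\<open>A\<close> and \<^term>\<open>B\<close> are two disjoint arcs of
  it in the same orientation, and one of them has to be traversed backwards.\<close>

lemma cyc_cross:
  assumes "A \<noteq> []" "B \<noteq> []" "P \<noteq> []" "distinct (A @ B @ P @ Q)"
    "successively adj A" "successively adj B"
    "successively adj (last A # P @ [last B])" "successively adj (hd B # Q @ [hd A])"
  shows "cyc (A @ P @ rev B @ Q)"
proof -
  obtain a A' where A: "A = a # A'" using assms by (cases A) auto
  obtain b B' where B: "B = b # B'" using assms by (cases B) auto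
  obtain p P' where P: "P = p # P'" using assms by (cases P) auto
  have "successively adj (rev B)"
    using assms(6) adj_sym by (simp add: successively_rev) (metis (mono_tags, lifting) successively_mono)
  then have "successively adj (A @ P @ rev B @ Q)" "adj (last (A @ P @ rev B @ Q)) (hd (A @ P @ rev B @ Q))"
    using assms
    by (auto simp: successively_append_iff successively_Cons last_rev hd_rev last_append hd_append)
  moreover have "3 \<le> length (A @ P @ rev B @ Q)"
    by (simp add: A B P)
  ultimately show ?thesis
    using assms(4) by (auto simp: cyc_def)
qed

lemma cyc_detour:
  assumes "length A \<ge> 2" "P \<noteq> []" "distinct (A @ P)" "successively adj A"
    "successively adj (last A # P @ [hd A])"
  shows "cyc (A @ P)"
proof -
  obtain p P' where P: "P = p # P'" using assms by (cases P) auto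
  obtain a A' where A: "A = a # A'" using assms by (cases A) auto
  show ?thesis
    using assms by (auto simp: cyc_def P A successively_append_iff successively_Cons split: if_splits)
qed

section \<open>Cycles as periodic sequences\<close>

lemma cyc_list_fun:
  assumes "cyc c"
  obtains f :: "nat \<Rightarrow> 'a" where "\<And>i j. f i = f j \<longleftrightarrow> i mod length c = j mod length c"
    "\<And>i. adj (f i) (f (Suc i))" "\<And>i. f ` {i..<i + length c} = set c"
proof -
  let ?L = "length c" and ?f = "\<lambda>i. c ! (i mod length c)"
  have L: "?L \<ge> 3" "distinct c" using assms by (auto simp: cyc_def)
  then have lt: "i mod ?L < ?L" for i by (intro mod_less_divisor) linarith
  have 1: "?f i = ?f j \<longleftrightarrow> i mod ?L = j mod ?L" for i j
    using lt L by (simp add: nth_eq_iff_index_eq)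
  have 2: "adj (?f i) (?f (Suc i))" for i
  proof (cases "Suc (i mod ?L) = ?L")
    case True
    then have "Suc i mod ?L = 0" by (simp add: mod_Suc)
    moreover have "c ! (i mod ?L) = last c" 
      using True L by (metis diff_Suc_1 last_conv_nth list.size(3) not_numeral_le_zero)
    moreover have "c ! 0 = hd c" using L by (intro hd_conv_nth[symmetric]) auto
    ultimately show ?thesis using assms by (simp add: cyc_def)
  next
    case False
    then have "Suc i mod ?L = Suc (i mod ?L)" by (simp add: mod_Suc)
    moreover have "Suc (i mod ?L) < ?L" using False lt[of i] by simp
    ultimately show ?thesis using assms by (simp add: cyc_def successively_conv_nth)
  qed
  have 3: "?f ` {i..<i + ?L} = set c" for i
  proof -
    have inj: "inj_on ?f {i..<i + ?L}"
    proof (rule inj_onI)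
      fix a b assume ab: "a \<in> {i..<i + ?L}" "b \<in> {i..<i + ?L}" "?f a = ?f b"
      have "a mod ?L = b mod ?L" using ab(3) 1 by blast
      with ab(1,2) show "a = b"
      proof (induction a b rule: linorder_wlog)
        case (le a b)
        then have "?L dvd b - a" by (metis mod_eq_dvd_iff_nat)
        moreover have "b - a < ?L" using le by auto
        ultimately show ?case using le by (auto dest: nat_dvd_not_less)
      qed auto
    qed
    have "?f ` {i..<i + ?L} \<subseteq> set c" using lt by auto
    then show ?thesis
      using inj L by (intro card_subset_eq) (auto simp: card_image distinct_card)
  qed
  show ?thesis using that[of ?f] 1 2 3 by blast
qed

text \<open>A cycle of length \<^term>\<open>L\<close> as an \<^term>\<open>L\<close>-periodic sequence, so that no arc needs
  special treatment at the end of the list.\<close>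

definition cyc_fun :: "(nat \<Rightarrow> 'a) \<Rightarrow> nat \<Rightarrow> bool" where
  "cyc_fun f L \<longleftrightarrow> 3 \<le> L \<and> (\<forall>i j. f i = f j \<longleftrightarrow> i mod L = j mod L) \<and> (\<forall>i. adj (f i) (f (Suc i)))"

text \<open>Toughness with the components replaced by representatives of some of them;
  \<^term>\<open>U\<close> is the complement of the deleted set.\<close>

definition tough_reps :: "real \<Rightarrow> bool" where
  "tough_reps t \<longleftrightarrow> (\<forall>U \<subseteq> V. \<forall>I \<subseteq> U. 2 \<le> card I \<and> (\<forall>u\<in>I. \<forall>v\<in>I. u \<noteq> v \<longrightarrow> \<not> conn U u v) \<longrightarrow>
    t * real (card I) + real (card U) \<le> real (card V))"

lemma cyc_fun_adj: "cyc_fun f L \<Longrightarrow> adj (f i) (f (Suc i))"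
  by (simp add: cyc_fun_def)

lemma cyc_fun_eq: "cyc_fun f L \<Longrightarrow> f i = f j \<longleftrightarrow> i mod L = j mod L"
  by (simp add: cyc_fun_def)

lemma cyc_fun_inj: "cyc_fun f L \<Longrightarrow> inj_on f {i..<i + L}"
  by (rule inj_onI) (metis atLeastLessThan_iff cyc_fun_eq mod_eq_window)

lemma cyc_fun_window:
  assumes "cyc_fun f L"
  shows "f ` {i..<i + L} = range f"
proof -
  have "f k \<in> f ` {i..<i + L}" for k
  proof -
    have L: "L > 0" using assms by (auto simp: cyc_fun_def)
    \<comment> \<open>On natural numbers \<open>(L - 1) * i\<close> serves as \<open>- i\<close>
      modulo \<open>L\<close>.\<close>
    let ?r = "(k + (L - 1) * i) mod L"
    have "i + (k + (L - 1) * i) = k + L * i"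
      using L by (cases L) auto
    then have "(i + ?r) mod L = k mod L"
      by (metis mod_add_right_eq mod_mult_self2)
    then have "f (i + ?r) = f k" using cyc_fun_eq[OF assms] by blast
    moreover have "i + ?r \<in> {i..<i + L}" using L by simp
    ultimately show ?thesis by (metis image_eqI)
  qed
  then show ?thesis by auto
qed

lemma cyc_fun_card: "cyc_fun f L \<Longrightarrow> card (range f) = L"
  using card_image[OF cyc_fun_inj, of f L 0] cyc_fun_window[of f L 0] by simp

lemma cyc_fun_period: "cyc_fun f L \<Longrightarrow> f (i + L) = f i"
  by (simp add: cyc_fun_eq)

lemma cyc_fun_range: "cyc_fun f L \<Longrightarrow> range f \<subseteq> V"
  using cyc_fun_adj adj_V by fast

lemma cyc_imp_cyc_fun:
  assumes "cyc c"
  obtains f where "cyc_fun f (length c)" "range f = set c"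
proof -
  obtain f :: "nat \<Rightarrow> 'a" where f: "\<And>i j. f i = f j \<longleftrightarrow> i mod length c = j mod length c"
    "\<And>i. adj (f i) (f (Suc i))" "\<And>i. f ` {i..<i + length c} = set c"
    by (rule cyc_list_fun[OF assms]) blast
  have fc: "cyc_fun f (length c)"
    unfolding cyc_fun_def using f(1,2) assms[unfolded cyc_def] by blast
  moreover have "range f = set c"
    using cyc_fun_window[OF fc, of 0] f(3)[of 0] by simp
  ultimately show ?thesis by (rule that)
qed

lemma cyc_subset_V:
  assumes "cyc c"
  shows "set c \<subseteq> V"
  using cyc_imp_cyc_fun[OF assms] cyc_fun_range by metis

section \<open>Arcs of a cycle and exchanges\<close>

lemma successively_map_arc:
  assumes "cyc_fun f L"
  shows "successively adj (map f [a..<b])"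
  using cyc_fun_adj[OF assms] by (auto simp: successively_conv_nth)

lemma distinct_map_arc:
  assumes "cyc_fun f L" "b \<le> a + L"
  shows "distinct (map f [a..<b])"
  using inj_on_subset[OF cyc_fun_inj[OF assms(1), of a], of "{a..<b}"] assms(2)
  by (auto simp: distinct_map)

lemma arc_detour:
  assumes f: "cyc_fun f L" and ij: "i < j" "j < i + L"
    and P: "P \<noteq> []" "distinct P" "set P \<inter> range f = {}" "successively adj (f i # P @ [f j])"
  obtains c where "cyc c" "set c = f ` {j..i + L} \<union> set P"
proof -
  let ?A = "map f [j..<Suc (i + L)]"
  have "last ?A = f i" using ij cyc_fun_period[OF f, of i] by (simp add: last_map)
  moreover have "hd ?A = f j" using ij by (simp add: hd_map del: upt_Suc)
  ultimately have "cyc (?A @ P)"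
    using ij P distinct_map_arc[OF f, of "Suc (i + L)" j] successively_map_arc[OF f, of j "Suc (i + L)"]
    by (intro cyc_detour) (auto simp del: upt_Suc)
  moreover have "set (?A @ P) = f ` {j..i + L} \<union> set P"
    by (simp add: atLeastLessThanSuc_atLeastAtMost del: upt_Suc)
  ultimately show ?thesis using that by blast
qed

text \<open>The new cycle runs from \<open>f (j + l)\<close> forwards to \<open>f i\<close>, along
  \<open>P\<close> to \<open>f j\<close>, backwards to \<open>f (i + k)\<close> and along
  \<open>Q\<close> to its start. For \<open>k = l = 1\<close> it loses no vertex.\<close>

lemma arc_cross:
  assumes f: "cyc_fun f L" and kl: "1 \<le> k" "1 \<le> l" "i + k \<le> j" "j + l \<le> i + L"
    and P: "P \<noteq> []" "distinct P" "set P \<inter> range f = {}" "successively adj (f i # P @ [f j])"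
    and Q: "distinct Q" "set Q \<inter> range f = {}" "successively adj (f (i + k) # Q @ [f (j + l)])"
    and PQ: "set P \<inter> set Q = {}"
  obtains c where "cyc c" "set c = f ` {i + k..j} \<union> f ` {j + l..i + L} \<union> set P \<union> set Q"
proof -
  let ?A = "map f [j + l..<Suc (i + L)]" and ?B = "map f [i + k..<Suc j]"
  have A: "last ?A = f i" "hd ?A = f (j + l)" "?A \<noteq> []"
    using kl cyc_fun_period[OF f, of i] by (auto simp: last_map hd_map simp del: upt_Suc)
  have B: "last ?B = f j" "hd ?B = f (i + k)" "?B \<noteq> []"
    using kl by (auto simp: last_map hd_map simp del: upt_Suc)
  have "f u \<noteq> f v" if "u \<in> {i + k..<Suc j}" "v \<in> {j + l..<Suc (i + L)}" for u v
    using that kl cyc_fun_eq[OF f] mod_eq_window[of u L v "Suc i"] by auto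
  then have "set ?A \<inter> set ?B = {}"
    by (fastforce simp del: upt_Suc)
  moreover have "distinct ?A" "distinct ?B"
    using kl by (auto intro!: distinct_map_arc[OF f] simp del: upt_Suc)
  ultimately have "distinct (?A @ ?B @ P @ Q)"
    using P(2,3) Q(1,2) PQ by (auto simp del: upt_Suc)
  then have "cyc (?A @ P @ rev ?B @ Q)"
    using A B P Q successively_map_arc[OF f] by (intro cyc_cross) (auto simp del: upt_Suc)
  moreover have "set (?A @ P @ rev ?B @ Q) = f ` {i + k..j} \<union> f ` {j + l..i + L} \<union> set P \<union> set Q"
    by (auto simp add: atLeastLessThanSuc_atLeastAtMost simp del: upt_Suc)
  ultimately show ?thesis using that by blast
qed

lemma cyc_fun_imp_cyc:
  assumes f: "cyc_fun f L"
  obtains c where "cyc c" "set c = range f"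
proof -
  have L: "3 \<le> L" using f by (simp add: cyc_fun_def)
  have "adj (f (L - 1)) (f 0)"
    using cyc_fun_adj[OF f, of "L - 1"] cyc_fun_period[OF f, of 0] L by simp
  then have "cyc (map f [0..<L])"
    using L distinct_map_arc[OF f, of L 0] successively_map_arc[OF f, of 0 L]
    by (simp add: cyc_def last_map hd_map)
  moreover have "set (map f [0..<L]) = range f"
    using cyc_fun_window[OF f, of 0] by simp
  ultimately show ?thesis by (rule that)
qed

text \<open>If \<^term>\<open>y\<close> cannot be inserted into the cycle, then \<^term>\<open>y\<close> and the successors of its
  neighbours lie in different components once the rest of the cycle is deleted.\<close>

lemma insertion_bound:
  assumes c: "cyc c" and y: "y \<in> V" "y \<notin> set c"
    and max: "\<And>c'. cyc c' \<Longrightarrow> \<not> insert y (set c) \<subseteq> set c'"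
    and tough: "tough_reps t" and t: "t \<le> real (card (set c))"
  defines "e \<equiv> card {w \<in> set c. adj y w}"
  shows "t * (real e + 1) + real e + real (card (V - set c)) \<le> real (card V)"
proof -
  obtain f where f: "cyc_fun f (length c)" and fc: "range f = set c"
    using cyc_imp_cyc_fun[OF c] .
  let ?L = "length c" and ?U = "V - set c"
  have L: "3 \<le> ?L" using f by (simp add: cyc_fun_def)
  have feq: "f i = f j \<longleftrightarrow> i mod ?L = j mod ?L" for i j using cyc_fun_eq[OF f] .
  define J where "J = {j. j < ?L \<and> adj y (f j)}"
  define Z where "Z = (\<lambda>j. f (Suc j)) ` J"
  have "inj_on (\<lambda>j. f (Suc j)) J"
  proof (rule inj_onI)
    fix i j assume ij: "i \<in> J" "j \<in> J" "f (Suc i) = f (Suc j)"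
    then have "(1 + i) mod ?L = (1 + j) mod ?L" using feq by simp
    then have "i mod ?L = j mod ?L" by (simp only: mod_add_cancel_nat)
    with ij show "i = j" by (simp add: J_def)
  qed
  then have "card Z = card J" unfolding Z_def by (rule card_image)
  also have "card J = card (f ` J)"
    by (intro card_image[symmetric] inj_on_subset[OF cyc_fun_inj[OF f, of 0]]) (auto simp: J_def)
  also have "f ` J = {w \<in> set c. adj y w}"
    unfolding fc[symmetric] cyc_fun_window[OF f, of 0, symmetric] by (auto simp: J_def)
  finally have cardZ: "card Z = e" by (simp add: e_def)
  have Zc: "Z \<subseteq> set c" using fc by (auto simp: Z_def)
  have ZV: "Z \<subseteq> V" using Zc cyc_subset_V[OF c] by auto
  \<comment> \<open>Otherwise a path through the component of \<open>y\<close> fits between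
    \<open>f j\<close> and \<open>f (Suc j)\<close>.\<close>
  have no1: "\<not> (adj (f (Suc j)) b \<and> conn ?U b y)" if "j \<in> J" for j b
  proof
    assume b: "adj (f (Suc j)) b \<and> conn ?U b y"
    obtain p where p: "p \<noteq> []" "distinct p" "set p \<subseteq> comp ?U y" "hd p = y" "last p = b" "successively adj p"
      using b conn_path conn_sym by metis
    have "successively adj (f j # p @ [f (Suc j)])"
      using p b that adj_sym by (auto simp: J_def successively_append_iff successively_Cons)
    moreover have "set p \<inter> range f = {}" using p(3) comp_subset fc by blast
    ultimately obtain c' where c': "cyc c'" "set c' = f ` {Suc j..j + ?L} \<union> set p"
      using arc_detour[OF f, of j "Suc j" p] p L by auto
    have "f ` {Suc j..j + ?L} = set c"
      using cyc_fun_window[OF f, of "Suc j"] fc by (simp add: atLeastLessThanSuc_atLeastAtMost)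
    moreover have "y \<in> set p" using p by (metis hd_in_set)
    ultimately show False using max c' by blast
  qed
  \<comment> \<open>Otherwise \<open>arc_cross\<close> with \<open>k = l = 1\<close> puts
    \<open>y\<close> between \<open>f i\<close> and \<open>f j\<close> and the link between their
    successors.\<close>
  have no2: False if ij: "i \<in> J" "j \<in> J" "i < j" and lnk: "lnk ?U (f (Suc i)) (f (Suc j))" for i j
  proof -
    obtain Q where Q: "distinct Q" "set Q \<subseteq> ?U" "successively adj (f (Suc i) # Q @ [f (Suc j)])"
      "\<And>q. q \<in> set Q \<Longrightarrow> \<exists>b. adj (f (Suc i)) b \<and> conn ?U b q"
      using lnk_path[OF lnk] by metis
    have "y \<notin> set Q" using Q(4) no1[OF ij(1)] by blast
    moreover have "successively adj (f i # [y] @ [f j])"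
      using ij adj_sym by (auto simp: J_def)
    moreover have "j + 1 \<le> i + ?L" using ij by (auto simp: J_def)
    ultimately obtain c' where c': "cyc c'"
      "set c' = f ` {i + 1..j} \<union> f ` {j + 1..i + ?L} \<union> set [y] \<union> set Q"
      using arc_cross[OF f, of 1 1 i j "[y]" Q] ij Q(1-3) fc y(2) by auto
    have "f ` {i + 1..<i + 1 + ?L} = set c" using cyc_fun_window[OF f] fc by metis
    moreover have "{i + 1..<i + 1 + ?L} \<subseteq> {i + 1..j} \<union> {j + 1..i + ?L}" by auto
    ultimately have "set c \<subseteq> f ` {i + 1..j} \<union> f ` {j + 1..i + ?L}" by blast
    then have "insert y (set c) \<subseteq> set c'" using c'(2) by auto
    then show False using max[OF c'(1)] by blast
  qed
  have nolnk: "\<not> lnk ?U u v" if uv: "u \<in> Z" "v \<in> Z" "id u \<noteq> id v" for u v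
  proof
    assume "lnk ?U u v"
    moreover obtain i j where "i \<in> J" "j \<in> J" "u = f (Suc i)" "v = f (Suc j)" using uv by (auto simp: Z_def)
    moreover from calculation uv have "i < j \<or> j < i" by (metis linorder_neqE_nat)
    ultimately show False using no2 lnk_sym by blast
  qed
  have disj: "Z \<inter> ?U = {}" using Zc by auto
  have ZZ: "\<not> conn (Z \<union> ?U) u v" if "u \<in> Z" "v \<in> Z" "u \<noteq> v" for u v
    using conn_label(2)[where l = id, OF _ that(1) disj nolnk that(2)] that by auto
  have Zy: "\<not> conn (Z \<union> ?U) u y" if u: "u \<in> Z" for u
  proof
    assume "conn (Z \<union> ?U) u y"
    then obtain x b where "x \<in> Z" "adj x b" "conn ?U b y"
      using conn_label(3)[where l = id, OF _ u disj nolnk] y by blast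
    then show False using no1 by (auto simp: Z_def)
  qed
  have fin: "finite Z" "finite ?U" using ZV finite_V by (auto intro: finite_subset)
  have "y \<notin> Z" using Zc y by blast
  then have cardI: "card (insert y Z) = e + 1" using fin cardZ by simp
  have cardU: "card (Z \<union> ?U) = e + card ?U" using fin disj cardZ by (simp add: card_Un_disjoint)
  show ?thesis
  proof (cases "e = 0")
    \<comment> \<open>Here \<open>y\<close> is the only representative, and toughness needs two; the
      bound on \<open>t\<close> takes its place.\<close>
    case True
    have "card (V - set c) + card (set c) = card V"
      using cyc_subset_V[OF c] finite_V
      by (metis add.commute card_Diff_subset card_mono finite_set le_add_diff_inverse)
    with True t show ?thesis by simp
  next
    case False
    have "\<forall>u\<in>insert y Z. \<forall>v\<in>insert y Z. u \<noteq> v \<longrightarrow> \<not> conn (Z \<union> ?U) u v"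
      using ZZ Zy conn_sym by blast
    then have "t * real (card (insert y Z)) + real (card (Z \<union> ?U)) \<le> real (card V)"
      using tough[unfolded tough_reps_def, rule_format, of "Z \<union> ?U" "insert y Z"] ZV y cardI False
      by auto
    then show ?thesis unfolding cardI cardU by (simp add: algebra_simps)
  qed
qed

text \<open>For \<^term>\<open>U\<close> the complement of a cycle, minimising \<^term>\<open>phi U\<close> keeps the largest component
  off the cycle small, keeps the number of such components small, and rewards extending the cycle.\<close>

definition phi :: "'a set \<Rightarrow> nat" where
  "phi U = (\<Sum>v\<in>U. (card V + 1) ^ card (comp U v))"

lemma finite_comp: "finite U \<Longrightarrow> finite (comp U u)"
  using comp_subset finite_subset by metis

lemma phi_psubset:
  assumes "finite U" "U' \<subset> U"
  shows "phi U' < phi U"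
proof -
  have fin: "finite U'" using assms finite_subset by blast
  have "phi U' \<le> (\<Sum>v\<in>U'. (card V + 1) ^ card (comp U v))"
    unfolding phi_def using assms
    by (intro sum_mono power_increasing card_mono finite_comp comp_mono) auto
  also obtain b where "b \<in> U - U'" using assms(2) by blast
  then have "(\<Sum>v\<in>U'. (card V + 1) ^ card (comp U v)) < phi U"
    unfolding phi_def using assms fin by (intro sum_strict_mono2[of U U' b]) auto
  finally show ?thesis .
qed

text \<open>The vertices of the first kind number at most \<open>card V\<close> and have smaller
  exponents than \<open>x\<close>; the base \<open>card V + 1\<close> makes \<open>x\<close>
  outweigh them all. The others lie in \<open>U - {x}\<close> and their weights have not
  grown.\<close>

lemma phi_less:
  assumes "finite U" "U' \<subseteq> V" "x \<in> U"
    and dich: "\<And>v. v \<in> U' \<Longrightarrow> card (comp U' v) < card (comp U x) \<or>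
      v \<in> U - comp U x \<and> comp U' v \<subseteq> comp U v"
  shows "phi U' < phi U"
proof -
  let ?N = "card V + 1" and ?h = "card (comp U x)"
  have fin: "finite U'" using assms(2) finite_V finite_subset by blast
  define A where "A = {v \<in> U'. card (comp U' v) < ?h}"
  have h: "0 < ?h" using mem_comp_self[OF assms(3)] finite_comp[OF assms(1)] by (auto simp: card_gt_0_iff)
  have B: "v \<in> U - comp U x \<and> comp U' v \<subseteq> comp U v" if "v \<in> U' - A" for v
    using dich[of v] that by (auto simp: A_def)
  have "phi U' = (\<Sum>v\<in>A. ?N ^ card (comp U' v)) + (\<Sum>v\<in>U' - A. ?N ^ card (comp U' v))"
    unfolding phi_def using fin by (subst add.commute, intro sum.subset_diff) (auto simp: A_def)
  also have "(\<Sum>v\<in>A. ?N ^ card (comp U' v)) \<le> (\<Sum>v\<in>A. ?N ^ (?h - 1))"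
    by (intro sum_mono power_increasing) (auto simp: A_def)
  also have "\<dots> \<le> card V * ?N ^ (?h - 1)"
    using card_mono[OF finite_V, of A] assms(2) by (auto simp: A_def)
  also have "\<dots> < ?N ^ ?h"
    using h by (cases ?h) auto
  also have "(\<Sum>v\<in>U' - A. ?N ^ card (comp U' v)) \<le> (\<Sum>v\<in>U' - A. ?N ^ card (comp U v))"
    using B assms(1) by (intro sum_mono power_increasing card_mono finite_comp) auto
  also have "\<dots> \<le> (\<Sum>v\<in>U - {x}. ?N ^ card (comp U v))"
    using B assms(1) mem_comp_self[OF assms(3)] by (intro sum_mono2) auto
  also have "?N ^ ?h + \<dots> = phi U"
    unfolding phi_def using assms(1,3) by (simp add: sum.remove)
  finally show ?thesis by simp
qed

lemma separated_card:
  assumes "finite U" "I \<subseteq> U" "\<And>u v. u \<in> I \<Longrightarrow> v \<in> I \<Longrightarrow> u \<noteq> v \<Longrightarrow> \<not> conn U u v"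
    and "\<And>u. u \<in> I \<Longrightarrow> h \<le> card (comp U u)"
  shows "h * card I \<le> card U"
proof -
  have fin: "finite I" using assms finite_subset by blast
  have "h * card I \<le> (\<Sum>u\<in>I. card (comp U u))"
    using sum_bounded_below[of I h] assms(4) by (simp add: mult.commute)
  also have "\<dots> = card (\<Union>u\<in>I. comp U u)"
  proof (intro card_UN_disjoint[symmetric] ballI impI fin finite_comp assms(1))
    fix u v assume "u \<in> I" "v \<in> I" "u \<noteq> v"
    then show "comp U u \<inter> comp U v = {}"
      using assms(3)[of u v] by (auto simp: comp_def dest: conn_sym intro: conn_trans)
  qed
  also have "\<dots> \<le> card U"
    using assms(1) comp_subset by (intro card_mono) auto
  finally show ?thesis .
qed

end

section \<open>Optimal cycles\<close>

locale optimal_cycle = simple_graph +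
  fixes f :: "nat \<Rightarrow> 'a" and L :: nat and x :: 'a
  assumes f: "cyc_fun f L"
    and optimal: "cyc c \<Longrightarrow> phi (V - range f) \<le> phi (V - set c)"
    and x: "x \<in> V - range f"
    and x_max: "v \<in> V - range f \<Longrightarrow> card (comp (V - range f) v) \<le> card (comp (V - range f) x)"
begin

abbreviation U where "U \<equiv> V - range f"
abbreviation H where "H \<equiv> comp U x"

section \<open>Neighbours of \<open>H\<close> on the cycle\<close>

definition idx :: "nat set" where
  "idx = {i. i < L \<and> (\<exists>h \<in> H. adj (f i) h)}"

text \<open>Indices run on past \<open>L\<close>, so the last gap wraps around; it is
  \<open>L\<close> if there is only one neighbour.\<close>

definition gap :: "nat \<Rightarrow> nat" where
  "gap i = (LEAST g. 0 < g \<and> (\<exists>h \<in> H. adj (f (i + g)) h))"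

definition seg :: "nat \<Rightarrow> nat \<Rightarrow> 'a set" where
  "seg i p = f ` {i<..i + p}"

text \<open>A small set can be dropped from the cycle without creating a component of the size of
  \<^term>\<open>H\<close>.\<close>

definition small :: "'a set \<Rightarrow> bool" where
  "small S \<longleftrightarrow> (\<forall>a\<in>S. card (comp (S \<union> U) a) < card H)"

definition pmin :: "nat \<Rightarrow> nat" where
  "pmin i = (LEAST p. \<not> small (seg i p))"

lemma L3: "3 \<le> L" and fV: "f i \<in> V" and finite_U: "finite U"
  using f cyc_fun_range[OF f] finite_V by (auto simp: cyc_fun_def)

lemma H_subset: "H \<subseteq> U" and x_in_H: "x \<in> H" and H_nonempty: "0 < card H"
proof -
  show "H \<subseteq> U" by (rule comp_subset)
  show "x \<in> H" using x by (rule mem_comp_self)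
  then show "0 < card H" using finite_comp[OF finite_U] by (auto simp: card_gt_0_iff)
qed

lemma H_closed: "h \<in> H \<Longrightarrow> adj h v \<Longrightarrow> v \<in> U \<Longrightarrow> v \<in> H"
  by (auto simp: comp_def intro: conn_step)

lemma no_larger_cycle:
  assumes "cyc c"
  shows "\<not> range f \<subset> set c"
proof
  assume c: "range f \<subset> set c"
  then have "V - set c \<subset> U"
    using cyc_subset_V[OF assms] by blast
  then show False
    using phi_psubset[OF finite_U] optimal[OF assms] by (meson leD)
qed

text \<open>Components of the new complement that meet \<open>S1\<close> or \<open>S2\<close> stay
  within one of these sets together with \<open>U\<close> and are smaller than \<open>H\<close>. All
  others lie inside old components, and those inside \<open>H\<close> have lost \<open>h\<close>. So
  \<open>phi_less\<close> contradicts optimality.\<close>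

lemma improvement:
  assumes c: "cyc c" and S: "small S1" "small S2" "S1 \<subseteq> range f" "S2 \<subseteq> range f"
    and nolnk: "\<And>a b. a \<in> S1 \<Longrightarrow> b \<in> S2 \<Longrightarrow> \<not> lnk U a b"
    and h: "h \<in> H" "h \<in> set c" and rest: "V - set c \<subseteq> S1 \<union> S2 \<union> U"
  shows False
proof -
  let ?R = "V - set c" and ?X = "S1 \<union> S2" and ?l = "\<lambda>a. a \<in> S1"
  have XU: "?X \<inter> U = {}" using S by blast
  have nl: "\<not> lnk U u v" if "u \<in> ?X" "v \<in> ?X" "?l u \<noteq> ?l v" for u v
    using that nolnk lnk_sym by blast
  have touch: "card (comp ?R v) < card H" if a: "a \<in> ?X" "conn ?R v a" for v a
  proof -
    have "comp (?X \<union> U) a \<subseteq> comp ({u \<in> ?X. ?l u = ?l a} \<union> U) a"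
      using conn_label(1)[where l = ?l, OF _ a(1) XU nl] by (auto simp: comp_def)
    moreover have "comp ?R v \<subseteq> comp (?X \<union> U) a"
      using comp_eq[OF a(2)] comp_mono[OF rest, of a] by simp
    ultimately have sub: "comp ?R v \<subseteq> comp ({u \<in> ?X. ?l u = ?l a} \<union> U) a" by blast
    obtain T where T: "small T" "a \<in> T" "{u \<in> ?X. ?l u = ?l a} \<subseteq> T" "T \<subseteq> range f"
    proof (cases "a \<in> S1")
      case True
      then show ?thesis using that[of S1] S by auto
    next
      case False
      then show ?thesis using that[of S2] S a by auto
    qed
    have "comp ({u \<in> ?X. ?l u = ?l a} \<union> U) a \<subseteq> comp (T \<union> U) a"
      using T(3) by (intro comp_mono) blast
    with sub have "comp ?R v \<subseteq> comp (T \<union> U) a" by (rule subset_trans)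
    moreover have "finite (T \<union> U)"
      using T(4) cyc_fun_range[OF f] finite_V by (meson Diff_subset Un_least finite_subset subset_trans)
    ultimately have "card (comp ?R v) \<le> card (comp (T \<union> U) a)"
      by (intro card_mono finite_comp)
    also have "\<dots> < card H" using T by (simp add: small_def)
    finally show ?thesis .
  qed
  have "phi ?R < phi U"
  proof (rule phi_less[OF finite_U _ x])
    fix v assume v: "v \<in> ?R"
    show "card (comp ?R v) < card H \<or> v \<in> U - H \<and> comp ?R v \<subseteq> comp U v"
    proof (cases "\<exists>a\<in>?X. conn ?R v a")
      case True
      then show ?thesis using touch by blast
    next
      case False
      then have inU: "comp ?R v \<subseteq> U"
        using rest comp_subset[of ?R v] unfolding comp_def by blast
      have sub: "comp ?R v \<subseteq> comp U v"
      proof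
        fix b assume "b \<in> comp ?R v"
        then have "conn (comp ?R v) v b" by (simp add: comp_def conn_comp[unfolded comp_def])
        then show "b \<in> comp U v" using inU by (simp add: comp_def) (rule conn_mono)
      qed
      have vU: "v \<in> U" using v inU mem_comp_self by blast
      show ?thesis
      proof (cases "v \<in> H")
        case True
        then have "comp U v = H" using comp_eq[of U x v] by (simp add: comp_def)
        moreover have "h \<notin> comp ?R v" using h(2) comp_subset[of ?R v] by blast
        ultimately have "comp ?R v \<subset> H" using sub h(1) by blast
        then show ?thesis using finite_comp[OF finite_U] psubset_card_mono by blast
      next
        case False
        then show ?thesis using vU sub by blast
      qed
    qed
  qed auto
  then show False using optimal[OF c] by simp
qed

lemma H_path:
  assumes "h \<in> H" "adj u h" "h' \<in> H" "adj u' h'"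
  obtains P where "P \<noteq> []" "distinct P" "set P \<subseteq> H" "successively adj (u # P @ [u'])"
proof -
  have hh: "conn U h h'"
    using assms(1,3) by (auto simp: comp_def intro: conn_trans conn_sym)
  obtain p where p: "p \<noteq> []" "distinct p" "set p \<subseteq> comp U h" "hd p = h" "last p = h'"
    "successively adj p"
    using conn_path[OF hh] by blast
  have "set p \<subseteq> H" using p(3) comp_eq[of U x h] assms(1) by (simp add: comp_def)
  moreover have "successively adj (u # p @ [u'])"
    using p assms adj_sym by (auto simp: successively_append_iff successively_Cons)
  ultimately show ?thesis using that p by blast
qed

text \<open>Consecutive neighbours of \<open>H\<close> could be joined through \<open>H\<close>,
  giving a larger cycle.\<close>

lemma some_non_nbr: "\<exists>i<L. i \<notin> idx"
proof (rule ccontr)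
  assume "\<not> ?thesis"
  then have "0 \<in> idx" "1 \<in> idx" using L3 by auto
  then obtain P where P: "P \<noteq> []" "distinct P" "set P \<subseteq> H" "successively adj (f 0 # P @ [f 1])"
    unfolding idx_def using H_path by blast
  have disj: "set P \<inter> range f = {}" using P(3) H_subset by blast
  have "1 < 0 + L" using L3 by simp
  then obtain c where c: "cyc c" "set c = f ` {1..0 + L} \<union> set P"
    using arc_detour[OF f zero_less_one _ P(1,2) disj P(4)] by blast
  have "f ` {1..0 + L} = range f"
    using cyc_fun_window[OF f, of 1] by (simp add: atLeastLessThanSuc_atLeastAtMost)
  then have "range f \<subset> set c" using c P disj by (cases P) auto
  then show False using no_larger_cycle[OF c(1)] by simp
qed

lemma card_idx: "card idx = card {w \<in> range f. \<exists>h \<in> H. adj w h}"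
proof -
  have "card idx = card (f ` idx)"
    by (intro card_image[symmetric] inj_on_subset[OF cyc_fun_inj[OF f, of 0]]) (auto simp: idx_def)
  also have "f ` idx = {w \<in> f ` {0..<0 + L}. \<exists>h \<in> H. adj w h}"
    by (auto simp: idx_def)
  also have "f ` {0..<0 + L} = range f"
    by (rule cyc_fun_window[OF f])
  finally show ?thesis .
qed

lemma gapI: "0 < g \<Longrightarrow> h \<in> H \<Longrightarrow> adj (f (i + g)) h \<Longrightarrow> gap i \<le> g"
  unfolding gap_def by (rule Least_le) blast

lemma gap_le_L: "i \<in> idx \<Longrightarrow> gap i \<le> L"
  using gapI[of L _ i] L3 cyc_fun_period[OF f, of i] by (auto simp: idx_def)

lemma gap_nbr:
  assumes "i \<in> idx"
  shows "0 < gap i" "\<exists>h \<in> H. adj (f (i + gap i)) h"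
proof -
  have "0 < L \<and> (\<exists>h \<in> H. adj (f (i + L)) h)"
    using assms L3 cyc_fun_period[OF f, of i] by (auto simp: idx_def)
  then have "0 < gap i \<and> (\<exists>h \<in> H. adj (f (i + gap i)) h)"
    unfolding gap_def by (rule LeastI)
  then show "0 < gap i" "\<exists>h \<in> H. adj (f (i + gap i)) h" by auto
qed

lemma gap_non_nbr: "0 < k \<Longrightarrow> k < gap i \<Longrightarrow> h \<in> H \<Longrightarrow> \<not> adj (f (i + k)) h"
  using gapI by (meson leD)

lemma gap_diff: "i \<in> idx \<Longrightarrow> j \<in> idx \<Longrightarrow> i < j \<Longrightarrow> gap i \<le> j - i \<and> gap j \<le> i + L - j"
  using gapI[of "j - i" _ i] gapI[of "i + L - j" _ j] cyc_fun_period[OF f, of i]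
  by (auto simp: idx_def)

text \<open>Going back from a common vertex by the smaller offset reaches a neighbour of
  \<open>H\<close> less than one gap behind the other one, so the two coincide.\<close>

lemma segments_disjoint:
  assumes "i \<in> idx" "j \<in> idx" "k < gap i" "l < gap j" "f (i + k) = f (j + l)"
  shows "i = j"
proof -
  have aux: "i = j" if "i \<in> idx" "j \<in> idx" "k < gap i" "f (i + k) = f (j + l)" "l \<le> k" for i j k l
  proof -
    have "(l + (i + (k - l))) mod L = (l + j) mod L"
      using that cyc_fun_eq[OF f] by (simp add: add.commute)
    then have *: "f (i + (k - l)) = f j"
      unfolding mod_add_cancel_nat using cyc_fun_eq[OF f] by blast
    obtain h where "h \<in> H" "adj (f j) h" using \<open>j \<in> idx\<close> by (auto simp: idx_def)
    then have "\<not> 0 < k - l"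
      using * \<open>k < gap i\<close> gap_non_nbr[of "k - l" i h] by (metis less_imp_diff_less)
    then have "k - l = 0" by simp
    with * have "f i = f j" by simp
    then show "i = j"
      using that cyc_fun_eq[OF f] by (simp add: idx_def)
  qed
  show ?thesis
    using aux[of i j k l] aux[of j i l k] assms by (cases "l \<le> k") auto
qed

lemma gap_less_L:
  assumes "i \<in> idx" "2 \<le> card idx"
  shows "gap i < L"
proof -
  have "idx \<noteq> {i}" using assms(2) by auto
  then obtain j where j: "j \<in> idx" "j \<noteq> i" using assms(1) by blast
  then show ?thesis
    using gap_diff[of i j] gap_diff[of j i] assms(1) by (cases "i < j") (auto simp: idx_def)
qed

lemma detour_rest:
  assumes "i \<in> idx" "gap i < L"
  obtains c where "cyc c" "range f - seg i (gap i - 1) \<subseteq> set c" "H \<inter> set c \<noteq> {}"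
proof -
  obtain h h' where h: "h \<in> H" "adj (f i) h" "h' \<in> H" "adj (f (i + gap i)) h'"
    using assms(1) gap_nbr(2)[OF assms(1)] by (auto simp: idx_def)
  obtain P where P: "P \<noteq> []" "distinct P" "set P \<subseteq> H" "successively adj (f i # P @ [f (i + gap i)])"
    using H_path[OF h] by blast
  have disj: "set P \<inter> range f = {}" using P(3) H_subset by blast
  have "i < i + gap i" "i + gap i < i + L" using gap_nbr(1)[OF assms(1)] assms(2) by auto
  then obtain c where c: "cyc c" "set c = f ` {i + gap i..i + L} \<union> set P"
    using arc_detour[OF f _ _ P(1,2) disj P(4)] by blast
  have "range f = f ` {i<..i + L}"
    using cyc_fun_window[OF f, of "Suc i"]
    by (simp add: atLeastLessThanSuc_atLeastAtMost atLeastSucAtMost_greaterThanAtMost)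
  also have "{i<..i + L} \<subseteq> {i<..i + (gap i - 1)} \<union> {i + gap i..i + L}"
    by auto
  finally have "range f - seg i (gap i - 1) \<subseteq> set c"
    unfolding seg_def c(2) by blast
  moreover have "H \<inter> set c \<noteq> {}" using P c(2) by (cases P) auto
  ultimately show ?thesis using that c(1) by blast
qed

lemma seg_range: "seg i p \<subseteq> range f"
  by (auto simp: seg_def)

lemma small_empty: "small {}"
  by (simp add: small_def)

text \<open>The detour through \<open>H\<close> drops only this segment, so
  \<open>improvement\<close> with an empty second set would apply.\<close>

lemma not_small_seg:
  assumes "i \<in> idx" "gap i < L"
  shows "\<not> small (seg i (gap i - 1))"
proof
  assume "small (seg i (gap i - 1))"
  moreover obtain c where "cyc c" "range f - seg i (gap i - 1) \<subseteq> set c" "H \<inter> set c \<noteq> {}"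
    using detour_rest[OF assms] .
  ultimately show False
    using improvement[of c "seg i (gap i - 1)" "{}"] small_empty seg_range by blast
qed

lemma pmin_props:
  assumes "i \<in> idx" "gap i < L"
  shows "\<not> small (seg i (pmin i))" "p < pmin i \<Longrightarrow> small (seg i p)" "pmin i < gap i"
proof -
  show "\<not> small (seg i (pmin i))"
    unfolding pmin_def using not_small_seg[OF assms] by (rule LeastI)
  show "p < pmin i \<Longrightarrow> small (seg i p)"
    unfolding pmin_def using not_less_Least by blast
  have "pmin i \<le> gap i - 1"
    unfolding pmin_def using not_small_seg[OF assms] by (rule Least_le)
  then show "pmin i < gap i" using gap_nbr(1)[OF assms(1)] by linarith
qed

text \<open>A link would allow a crossing exchange with a path through \<open>H\<close> from
  \<open>f i\<close> to \<open>f j\<close>. It drops only \<open>seg i (k - 1)\<close> and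
  \<open>seg j (l - 1)\<close>, which are small because they are shorter than \<open>pmin i\<close>
  and \<open>pmin j\<close>, and unlinked by induction on \<open>k + l\<close>; this contradicts
  \<open>improvement\<close>.\<close>

lemma no_link:
  assumes idx2: "2 \<le> card idx" and ij: "i \<in> idx" "j \<in> idx" "i < j"
  shows "1 \<le> k \<Longrightarrow> k \<le> pmin i \<Longrightarrow> 1 \<le> l \<Longrightarrow> l \<le> pmin j \<Longrightarrow> \<not> lnk U (f (i + k)) (f (j + l))"
proof (induction "k + l" arbitrary: k l rule: less_induct)
  case less
  have gi: "gap i < L" "gap j < L" using gap_less_L idx2 ij by auto
  note pi = pmin_props[OF ij(1) gi(1)] and pj = pmin_props[OF ij(2) gi(2)]
  have gaps: "gap i \<le> j - i" "gap j \<le> i + L - j" using gap_diff[OF ij] by auto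
  show ?case
  proof
    assume lnk: "lnk U (f (i + k)) (f (j + l))"
    obtain Q where Q: "distinct Q" "set Q \<subseteq> U" "successively adj (f (i + k) # Q @ [f (j + l)])"
      "\<And>q. q \<in> set Q \<Longrightarrow> \<exists>b. adj (f (i + k)) b \<and> conn U b q"
      using lnk_path[OF lnk] by metis
    \<comment> \<open>Strictly inside a gap \<open>f (i + k)\<close> has no neighbour in
      \<open>H\<close>, so the link avoids \<open>H\<close> and hence \<open>P\<close>.\<close>
    have QH: "q \<notin> H" if q: "q \<in> set Q" for q
    proof
      assume "q \<in> H"
      then obtain b where "adj (f (i + k)) b" "b \<in> H"
        using Q(4)[OF q] by (auto simp: comp_def intro: conn_trans conn_sym)
      then show False using gap_non_nbr[of k i b] less.prems pi(3) by simp
    qed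
    obtain h h' where h: "h \<in> H" "adj (f i) h" "h' \<in> H" "adj (f j) h'"
      using ij by (auto simp: idx_def)
    obtain P where P: "P \<noteq> []" "distinct P" "set P \<subseteq> H" "successively adj (f i # P @ [f j])"
      using H_path[OF h] by blast
    have disj: "set P \<inter> range f = {}" "set Q \<inter> range f = {}" "set P \<inter> set Q = {}"
      using P(3) H_subset Q(2) QH by blast+
    have le: "i + k \<le> j" "j + l \<le> i + L"
      using gaps less.prems pi(3) pj(3) by linarith+
    obtain c where c: "cyc c"
      "set c = f ` {i + k..j} \<union> f ` {j + l..i + L} \<union> set P \<union> set Q"
      using arc_cross[OF f less.prems(1,3) le P(1,2) disj(1) P(4) Q(1) disj(2) Q(3) disj(3)] .
    have "range f = f ` {i<..i + L}"
      using cyc_fun_window[OF f, of "Suc i"]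
      by (simp add: atLeastLessThanSuc_atLeastAtMost atLeastSucAtMost_greaterThanAtMost)
    also have "{i<..i + L} \<subseteq> {i<..i + (k - 1)} \<union> {i + k..j} \<union> {j<..j + (l - 1)} \<union> {j + l..i + L}"
      by auto
    finally have rest: "V - set c \<subseteq> seg i (k - 1) \<union> seg j (l - 1) \<union> U"
      unfolding seg_def c(2) by blast
    have "\<not> lnk U a b" if ab: "a \<in> seg i (k - 1)" "b \<in> seg j (l - 1)" for a b
    proof -
      obtain k' where k': "a = f k'" "i < k'" "k' \<le> i + (k - 1)"
        using ab(1) unfolding seg_def by force
      obtain l' where l': "b = f l'" "j < l'" "l' \<le> j + (l - 1)"
        using ab(2) unfolding seg_def by force
      have "k' - i + (l' - j) < k + l" "1 \<le> k' - i" "k' - i \<le> pmin i" "1 \<le> l' - j" "l' - j \<le> pmin j"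
        using k'(2,3) l'(2,3) less.prems by linarith+
      from less.hyps[OF this] show ?thesis
        using k' l' by simp
    qed
    moreover have "small (seg i (k - 1))" "small (seg j (l - 1))"
      using pi(2)[of "k - 1"] pj(2)[of "l - 1"] less.prems by linarith+
    moreover obtain h where "h \<in> H" "h \<in> set c" using P c(2) by (cases P) auto
    ultimately show False
      using improvement[OF c(1)] seg_range rest by blast
  qed
qed

text \<open>Behind every neighbour of \<^term>\<open>H\<close> there is an initial piece of the cycle which, with the
  components it touches, is as large as \<^term>\<open>H\<close>; these sets are pairwise separated.\<close>

lemma tough_size:
  assumes tough: "tough_reps t" and idx2: "2 \<le> card idx"
  shows "(t + real (card H)) * (real (card idx) + 1) \<le> real (card V)"
proof -
  have fin: "finite idx" by (rule finite_subset[of _ "{..<L}"]) (auto simp: idx_def)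
  have gL: "gap i < L" if "i \<in> idx" for i using that idx2 by (rule gap_less_L)
  note pm = pmin_props[OF _ gL]
  define S where "S i = seg i (pmin i)" for i
  define X where "X = (\<Union>i\<in>idx. S i)"
  have S_elem: "\<exists>k. 1 \<le> k \<and> k \<le> pmin i \<and> a = f (i + k)" if "a \<in> S i" for a i
  proof -
    obtain n where "a = f n" "i < n" "n \<le> i + pmin i"
      using \<open>a \<in> S i\<close> unfolding S_def seg_def by force
    then show ?thesis by (intro exI[of _ "n - i"]) auto
  qed
  have uniq: "i = j" if ij: "i \<in> idx" "j \<in> idx" "a \<in> S i" "a \<in> S j" for i j a
  proof -
    obtain k l where "k \<le> pmin i" "a = f (i + k)" "l \<le> pmin j" "a = f (j + l)"
      using S_elem ij(3,4) by metis
    then show ?thesis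
      using segments_disjoint[OF ij(1,2), of k l] pm(3)[OF ij(1) ij(1)] pm(3)[OF ij(2) ij(2)] by simp
  qed
  \<comment> \<open>The label of a vertex of \<open>X\<close> is the index whose segment contains
    it; by \<open>uniq\<close> there is just one.\<close>
  define l where "l a = (THE i. i \<in> idx \<and> a \<in> S i)" for a
  have l: "l a = i" if "i \<in> idx" "a \<in> S i" for i a
    unfolding l_def using that uniq by (intro the_equality) auto
  have XU: "X \<inter> U = {}" using seg_range by (auto simp: X_def S_def)
  have nl: "\<not> lnk U u v" if uv: "u \<in> X" "v \<in> X" "l u \<noteq> l v" for u v
  proof -
    obtain i j where ij: "i \<in> idx" "u \<in> S i" "j \<in> idx" "v \<in> S j" using uv by (auto simp: X_def)
    then have "i < j \<or> j < i" using l uv(3) by (metis linorder_neqE_nat)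
    moreover obtain k k' where "1 \<le> k" "k \<le> pmin i" "u = f (i + k)" "1 \<le> k'" "k' \<le> pmin j" "v = f (j + k')"
      using S_elem ij by metis
    ultimately show ?thesis
      using no_link[OF idx2] ij lnk_sym by blast
  qed
  have "\<forall>i\<in>idx. \<exists>r. r \<in> S i \<and> card H \<le> card (comp (S i \<union> U) r)"
    using pm(1) unfolding small_def S_def by (meson not_le)
  then obtain r where r: "\<And>i. i \<in> idx \<Longrightarrow> r i \<in> S i"
    "\<And>i. i \<in> idx \<Longrightarrow> card H \<le> card (comp (S i \<union> U) (r i))"
    by metis
  have rX: "r i \<in> X" if "i \<in> idx" for i using r(1) that by (auto simp: X_def)
  have XUV: "X \<union> U \<subseteq> V" using fV seg_range by (auto simp: X_def S_def seg_def)
  have finXU: "finite (X \<union> U)" using XUV finite_V by (rule finite_subset)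
  \<comment> \<open>One vertex of \<open>H\<close>, and behind each neighbour one that lies in a
    large component.\<close>
  define R where "R = insert x (r ` idx)"
  have sep1: "i = j" if "i \<in> idx" "j \<in> idx" "conn (X \<union> U) (r i) (r j)" for i j
    using conn_label(2)[where l = l, OF that(3) rX[OF that(1)] XU nl rX[OF that(2)]] l r(1) that by metis
  have sep2: "\<not> conn (X \<union> U) (r i) x" if i: "i \<in> idx" for i
  proof
    assume "conn (X \<union> U) (r i) x"
    then obtain u b where u: "u \<in> X" "adj u b" "conn U b x"
      using conn_label(3)[where l = l, OF _ rX[OF i] XU nl _] x by blast
    then have b: "b \<in> H" by (auto simp: comp_def intro: conn_sym)
    obtain j where "j \<in> idx" "u \<in> S j" using u(1) by (auto simp: X_def)
    then obtain k where j: "j \<in> idx" "1 \<le> k" "k \<le> pmin j" "u = f (j + k)"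
      using S_elem by metis
    then show False
      using gap_non_nbr[of k j b] b u(2) pm(3)[OF j(1) j(1)] by simp
  qed
  have sep: "\<not> conn (X \<union> U) u v" if "u \<in> R" "v \<in> R" "u \<noteq> v" for u v
    using that sep1 sep2 conn_sym unfolding R_def by blast
  have "inj_on r idx"
    using l r(1) by (metis inj_onI)
  moreover have "x \<notin> r ` idx" using XU rX x by blast
  ultimately have cardR: "card R = card idx + 1"
    using fin by (simp add: R_def card_image)
  have big: "card H \<le> card (comp (X \<union> U) u)" if "u \<in> R" for u
  proof (cases "u = x")
    case True
    then show ?thesis by (auto intro!: card_mono finite_comp finXU comp_mono)
  next
    case False
    then obtain i where i: "i \<in> idx" "u = r i" using \<open>u \<in> R\<close> by (auto simp: R_def)
    have "card (comp (S i \<union> U) u) \<le> card (comp (X \<union> U) u)"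
      using i by (intro card_mono finite_comp finXU comp_mono) (auto simp: X_def)
    then show ?thesis using r(2)[OF i(1)] i by simp
  qed
  have RXU: "R \<subseteq> X \<union> U" using rX x by (auto simp: R_def)
  have "card H * card R \<le> card (X \<union> U)"
    using separated_card[OF finXU RXU sep big] .
  then have "real (card H) * real (card R) \<le> real (card (X \<union> U))"
    by (metis of_nat_mono of_nat_mult)
  moreover have "t * real (card R) + real (card (X \<union> U)) \<le> real (card V)"
  proof -
    have "2 \<le> card R \<and> (\<forall>u\<in>R. \<forall>v\<in>R. u \<noteq> v \<longrightarrow> \<not> conn (X \<union> U) u v)"
      using sep cardR idx2 by simp
    then show ?thesis using tough[unfolded tough_reps_def] XUV RXU by blast
  qed
  ultimately show ?thesis
    unfolding cardR by (simp add: algebra_simps)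
qed

text \<open>Deleting the neighbours of \<open>H\<close> on the cycle separates \<open>x\<close> from
  a cycle vertex that is not such a neighbour; toughness is applied to these two
  representatives.\<close>

lemma idx_tough:
  assumes tough: "tough_reps t" and t: "1 \<le> t"
  shows "2 * t \<le> real (card idx)"
proof -
  let ?W = "{w \<in> range f. \<exists>h \<in> H. adj w h}"
  obtain i where i: "i < L" "i \<notin> idx" using some_non_nbr by blast
  then have fi: "f i \<notin> ?W" by (auto simp: idx_def)
  have nc: "\<not> conn (V - ?W) x (f i)"
  proof
    assume "conn (V - ?W) x (f i)"
    then have "f i \<in> H"
    proof (induction rule: conn_induct)
      case base
      show ?case by (rule x_in_H)
    next
      case (step v w)
      then show ?case using H_closed[of v w] adj_sym by blast
    qed
    then show False using H_subset by blast
  qed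
  then have nc': "\<not> conn (V - ?W) (f i) x" using conn_sym by blast
  have "x \<noteq> f i" using x by auto
  have "?W \<subseteq> V" using cyc_fun_range[OF f] by auto
  have sub: "{x, f i} \<subseteq> V - ?W" using fi x fV[of i] by auto
  have "2 \<le> card {x, f i} \<and> (\<forall>u\<in>{x, f i}. \<forall>v\<in>{x, f i}. u \<noteq> v \<longrightarrow> \<not> conn (V - ?W) u v)"
    using nc nc' \<open>x \<noteq> f i\<close> by (simp del: Diff_iff)
  then have "t * real (card {x, f i}) + real (card (V - ?W)) \<le> real (card V)"
    using tough[unfolded tough_reps_def] sub by blast
  moreover have "real (card (V - ?W)) = real (card V) - real (card ?W)"
    using \<open>?W \<subseteq> V\<close> finite_V by (simp add: card_Diff_subset finite_subset card_mono of_nat_diff)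
  ultimately show ?thesis
    using \<open>x \<noteq> f i\<close> by (simp add: card_idx)
qed

end

section \<open>Degree sums\<close>

context simple_graph
begin

definition ore :: "real \<Rightarrow> bool" where
  "ore s \<longleftrightarrow> (\<forall>u\<in>V. \<forall>v\<in>V. u \<noteq> v \<longrightarrow> \<not> adj u v \<longrightarrow> s < real (deg u) + real (deg v))"

lemma nbr_in_V: "adj u v \<Longrightarrow> v \<in> V"
  using adj_V adj_sym by blast

text \<open>Toughness at least 1 excludes vertices with fewer than two neighbours and cut vertices.
  So two neighbours of \<open>u\<close> are joined by a path avoiding \<open>u\<close>, which
  \<open>u\<close> closes to a cycle.\<close>

lemma exists_cyc:
  assumes tough: "tough_reps t" and t: "1 \<le> t" and V3: "3 \<le> card V"
  shows "\<exists>c. cyc c"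
proof -
  obtain u where u: "u \<in> V" using V3 by fastforce
  let ?N = "{w. adj u w}"
  have NV: "?N \<subseteq> V" using nbr_in_V by blast
  have two: "2 \<le> card ?N"
  proof (rule ccontr)
    assume N: "\<not> 2 \<le> card ?N"
    have "card (insert u ?N) < card V"
      using N V3 finite_nbrs[of u] by (simp add: card_insert_if)
    then obtain v where v: "v \<in> V" "v \<noteq> u" "\<not> adj u v"
      using finite_nbrs[of u] by (metis card_mono finite_insert insert_iff leD mem_Collect_eq subsetI)
    have "w = u" if "conn (V - ?N) u w" for w
      using that by (induction rule: conn_induct) auto
    then have "\<not> conn (V - ?N) u v" "\<not> conn (V - ?N) v u" using v(2) conn_sym by blast+
    moreover have "{u, v} \<subseteq> V - ?N" using u v adj_irrefl by auto
    ultimately have "t * real (card {u, v}) + real (card (V - ?N)) \<le> real (card V)"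
      using tough v(2) unfolding tough_reps_def by (metis (no_types, lifting) Diff_subset card_2_iff insertE order_refl singletonD)
    moreover have "real (card (V - ?N)) = real (card V) - real (card ?N)"
      using finite_V NV by (simp add: card_Diff_subset finite_nbrs card_mono of_nat_diff)
    ultimately show False using N v(2) t by simp
  qed
  obtain b c where bc: "adj u b" "adj u c" "b \<noteq> c"
    using two by (metis (no_types, lifting) card_le_Suc0_iff_eq finite_nbrs mem_Collect_eq not_less_eq_eq numeral_2_eq_2)
  have conn: "conn (V - {u}) b c"
  proof (rule ccontr)
    assume n: "\<not> conn (V - {u}) b c"
    then have "\<not> conn (V - {u}) c b" using conn_sym by blast
    moreover have "{b, c} \<subseteq> V - {u}" using bc nbr_in_V adj_irrefl by auto
    ultimately have "t * real (card {b, c}) + real (card (V - {u})) \<le> real (card V)"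
      using tough n bc(3) unfolding tough_reps_def by (metis (no_types, lifting) Diff_subset card_2_iff insertE order_refl singletonD)
    then show False using u finite_V bc(3) t V3 by (simp add: card_Diff_singleton of_nat_diff)
  qed
  obtain p where p: "p \<noteq> []" "distinct p" "set p \<subseteq> comp (V - {u}) b" "hd p = b" "last p = c"
    "successively adj p"
    using conn_path[OF conn] by blast
  have "u \<notin> set p" using p(3) comp_subset[of "V - {u}" b] by blast
  moreover have "2 \<le> length p"
  proof (cases p)
    case (Cons a q)
    then show ?thesis using p bc(3) by (cases q) auto
  qed (use p in simp)
  ultimately have "cyc (u # p)"
    using p bc adj_sym by (auto simp: cyc_def successively_Cons)
  then show ?thesis ..
qed

lemma card_le_Un: "finite A \<Longrightarrow> finite B \<Longrightarrow> X \<subseteq> A \<union> B \<Longrightarrow> card X \<le> card A + card B" for A B X :: "'a set"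
  by (meson card_Un_le card_mono finite_UnI le_trans)

lemma deg_comp:
  assumes "U \<subseteq> V" "u \<in> U"
  shows "deg u + 1 \<le> card (comp U u) + card {w \<in> V - U. adj u w}"
proof -
  have fin: "finite (comp U u)" using assms finite_V finite_comp finite_subset by metis
  have "{w. adj u w} \<subseteq> (comp U u - {u}) \<union> {w \<in> V - U. adj u w}"
  proof
    fix w assume "w \<in> {w. adj u w}"
    then have w: "adj u w" "w \<in> V" "w \<noteq> u" using nbr_in_V adj_irrefl by auto
    then show "w \<in> (comp U u - {u}) \<union> {w \<in> V - U. adj u w}"
      using conn_step[OF conn_refl[OF assms(2)] w(1)] by (auto simp: comp_def)
  qed
  then have "deg u \<le> card (comp U u - {u}) + card {w \<in> V - U. adj u w}"
    unfolding deg_def using fin finite_V by (intro card_le_Un) auto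
  moreover have "card (comp U u) > 0" using fin mem_comp_self[OF assms(2)] by (auto simp: card_gt_0_iff)
  ultimately show ?thesis
    using fin mem_comp_self[OF assms(2)] by simp
qed

text \<open>The degrees of two representatives are bounded by their components and the deleted set,
  and the other \<open>card I - 2\<close> representatives occupy further vertices of
  \<open>U\<close>. The degree sum is an integer and thus at least \<open>card V\<close>, so
  \<open>card I\<close> is at most the size of the deleted set.\<close>

lemma ore_tough_1:
  assumes ore: "ore (real (card V) - 1)"
  shows "tough_reps 1"
  unfolding tough_reps_def
proof (intro allI impI)
  fix U I assume U: "U \<subseteq> V" and I: "I \<subseteq> U"
    and sep: "2 \<le> card I \<and> (\<forall>u\<in>I. \<forall>v\<in>I. u \<noteq> v \<longrightarrow> \<not> conn U u v)"
  have finU: "finite U" using U finite_V by (rule finite_subset)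
  have finI: "finite I" using I finU by (rule finite_subset)
  obtain u v where uv: "u \<in> I" "v \<in> I" "u \<noteq> v"
    using sep finI by (metis card_le_Suc0_iff_eq not_less_eq_eq numeral_2_eq_2)
  have nconn: "\<not> conn U u v" using sep uv by blast
  have "\<not> adj u v"
    using nconn conn_step[OF conn_refl] I uv by blast
  then have "real (card V) - 1 < real (deg u) + real (deg v)"
    using ore uv I U unfolding ore_def by blast
  moreover have nb: "card {w \<in> V - U. adj z w} \<le> card V - card U" for z
  proof -
    have "card {w \<in> V - U. adj z w} \<le> card (V - U)" using finite_V by (intro card_mono) auto
    then show ?thesis using U finU by (simp add: card_Diff_subset)
  qed
  moreover have "deg u + 1 \<le> card (comp U u) + card {w \<in> V - U. adj u w}"
    "deg v + 1 \<le> card (comp U v) + card {w \<in> V - U. adj v w}"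
    using deg_comp[OF U] uv I by auto
  moreover have "card (comp U u) + card (comp U v) + (card I - 2) \<le> card U"
  proof -
    have d: "comp U u \<inter> comp U v = {}"
      using nconn by (auto simp: comp_def dest: conn_sym intro: conn_trans)
    have d': "(comp U u \<union> comp U v) \<inter> (I - {u, v}) = {}"
      using sep uv by (auto simp: comp_def)
    have "card (comp U u) + card (comp U v) + card (I - {u, v}) = card (comp U u \<union> comp U v \<union> (I - {u, v}))"
      using d d' finI finite_comp[OF finU] by (simp add: card_Un_disjoint)
    also have "\<dots> \<le> card U"
      using comp_subset[of U] I finU by (intro card_mono) auto
    also have "card (I - {u, v}) = card I - 2"
      using uv finI by (simp add: card_Diff_subset)
    finally show ?thesis .
  qed
  moreover have "card U \<le> card V" using U finite_V by (rule card_mono[rotated])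
  ultimately have "card I + card U \<le> card V" using sep nb[of u] nb[of v] by linarith
  then show "1 * real (card I) + real (card U) \<le> real (card V)" by simp
qed

end

section \<open>Combining the size bounds with the degree condition\<close>

context optimal_cycle
begin

lemma card_idx_le: "card idx \<le> L"
  using card_mono[of "{..<L}" idx] by (auto simp: idx_def)

lemma deg_x: "deg x + 1 \<le> card H + card idx"
proof -
  have "{w \<in> V - U. adj x w} \<subseteq> {w \<in> range f. \<exists>h \<in> H. adj w h}"
    using x_in_H adj_sym by blast
  moreover have "finite {w \<in> range f. \<exists>h \<in> H. adj w h}"
    using cyc_fun_range[OF f] finite_V finite_subset by (metis (no_types, lifting) mem_Collect_eq subsetI)
  ultimately have "card {w \<in> V - U. adj x w} \<le> card idx"
    unfolding card_idx by (intro card_mono)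
  then show ?thesis using deg_comp[of U x] x by simp
qed

text \<open>Here \<^term>\<open>l\<close> and \<^term>\<open>k\<close> are the orders of two components off the cycle, \<^term>\<open>m\<close> is
  the number of neighbours of the first one on the cycle, \<^term>\<open>e\<close> is the number of
  neighbours on the cycle of a vertex of the second one, and \<^term>\<open>d\<close>, \<^term>\<open>d'\<close> are degrees.\<close>

lemma multi_component_arith:
  fixes n t m l k e d d' :: real
  assumes t: "1 \<le> t" and m: "2 * t \<le> m" and k: "k \<le> l" "1 \<le> l"
    and size: "(t + l) * (m + 1) \<le> n" and e: "t * (e + 1) + e + (l + k) \<le> n"
    and d: "d + 1 \<le> l + m" "d' + 1 \<le> k + e"
    and ore: "2 * n / (t + 1) + t - 2 < d + d'"
  shows False
proof -
  have "2 * n / (t + 1) < l + m + k + e - t" using ore d by linarith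
  then have "2 * n < (l + m + k + e - t) * (t + 1)" using t by (simp add: divide_less_eq)
  moreover have "k * t \<le> l * t" using k t by simp
  \<comment> \<open>Together with \<open>size\<close>, \<open>e\<close> and
    \<open>k * t \<le> l * t\<close>, the degree condition leaves
    \<open>0 < - (l - 1) * (m + 1 - 2 * t) - t * t - t - 1\<close>.\<close>
  moreover have "0 \<le> (l - 1) * (m + 1 - 2 * t)" using k m by simp
  moreover have "0 \<le> t * t" by simp
  ultimately show False using size e t m by (simp only: algebra_simps)
qed

text \<open>A vertex \<open>y\<close> of another component cannot be inserted into the cycle, so it
  has few neighbours there; the degree of \<open>x\<close> is limited by the size bound. As
  \<open>x\<close> and \<open>y\<close> are nonadjacent, their degree sum is too small.\<close>

lemma one_component:
  assumes tough: "tough_reps t" and t: "1 \<le> t" and ore: "ore (2 * real (card V) / (t + 1) + t - 2)"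
  shows "U = H"
proof (rule ccontr)
  assume "U \<noteq> H"
  then obtain y where y: "y \<in> U" "y \<notin> H" using H_subset by blast
  obtain c where c: "cyc c" "set c = range f" using cyc_fun_imp_cyc[OF f] .
  have m: "2 * t \<le> real (card idx)" using idx_tough[OF tough t] .
  then have m2: "2 \<le> card idx" using t by linarith
  define e where "e = card {w \<in> range f. adj y w}"
  have tL: "t \<le> real (card (set c))"
    using m t card_idx_le cyc_fun_card[OF f] c(2) by simp
  have max: "\<not> insert y (set c) \<subseteq> set c'" if "cyc c'" for c'
    using no_larger_cycle[OF that] y(1) c(2) by blast
  have ib: "t * (real e + 1) + real e + real (card U) \<le> real (card V)"
    using insertion_bound[OF c(1) _ _ max tough tL] y(1) unfolding c(2) e_def by blast
  have "H \<inter> comp U y = {}"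
    using y(2) by (auto simp: comp_def dest: conn_sym intro: conn_trans)
  then have "card H + card (comp U y) = card (H \<union> comp U y)"
    using finite_comp[OF finite_U] by (simp add: card_Un_disjoint)
  also have "\<dots> \<le> card U" using finite_U comp_subset by (intro card_mono) auto
  finally have "real (card H) + real (card (comp U y)) \<le> real (card U)" by linarith
  then have eb: "t * (real e + 1) + real e + (real (card H) + real (card (comp U y))) \<le> real (card V)"
    using ib by linarith
  have "V - U = range f" using cyc_fun_range[OF f] by blast
  then have dy: "real (deg y) + 1 \<le> real (card (comp U y)) + real e"
    using deg_comp[of U y] y(1) by (simp add: e_def)
  have dx: "real (deg x) + 1 \<le> real (card H) + real (card idx)"
    using deg_x by linarith
  have "x \<noteq> y" using x_in_H y(2) by blast
  moreover have "\<not> adj x y" using H_closed[OF x_in_H] y by blast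
  ultimately have o: "2 * real (card V) / (t + 1) + t - 2 < real (deg x) + real (deg y)"
    using ore x y(1) unfolding ore_def by blast
  have kl: "real (card (comp U y)) \<le> real (card H)" "1 \<le> real (card H)"
    using x_max[OF y(1)] H_nonempty by simp_all
  show False
    using multi_component_arith[OF t m kl tough_size[OF tough m2] eb dx dy o] .
qed

lemma gap_bound:
  assumes "\<And>j. j \<in> idx \<Longrightarrow> g \<le> gap j"
  shows "card idx * g \<le> L"
proof (cases "idx = {}")
  case False
  have inj: "inj_on (\<lambda>(j, k). f (j + k)) (idx \<times> {..<g})"
  proof (rule inj_onI, clarify)
    fix i k j l assume a: "i \<in> idx" "j \<in> idx" "k < g" "l < g" "f (i + k) = f (j + l)"
    have "i = j" using segments_disjoint[OF a(1,2) _ _ a(5)] a assms by fastforce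
    moreover from this have "i + k = j + l"
      using a assms[of i] gap_le_L[of i] cyc_fun_eq[OF f] mod_eq_window[of "i + k" L "i + l" i] by simp
    ultimately show "i = j \<and> k = l" by simp
  qed
  have "card idx * g = card ((\<lambda>(j, k). f (j + k)) ` (idx \<times> {..<g}))"
    using card_image[OF inj] by (simp add: card_cartesian_product)
  also have "\<dots> \<le> card (range f)"
    using cyc_fun_range[OF f] finite_V by (intro card_mono) (auto intro: finite_subset)
  finally show ?thesis by (simp add: cyc_fun_card[OF f])
qed simp

text \<open>Here \<^term>\<open>g\<close> is the smallest gap between neighbours of \<^term>\<open>H\<close> on the cycle and
  \<^term>\<open>s\<close> is the number of vertices of that gap not yet inserted again.\<close>

lemma one_component_arith:
  fixes n t m h e d d' s g :: real
  assumes t: "1 \<le> t" and m: "2 * t \<le> m" and h: "1 \<le> h"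
    and size: "(t + h) * (m + 1) \<le> n" and e: "t * (e + 1) + e + s \<le> n"
    and d: "d + 1 \<le> h + m" "d' + 1 \<le> e + s" and s: "s + 1 \<le> g" and g: "m * g \<le> n - h"
    and ore: "2 * n / (t + 1) + t - 2 < d + d'"
  shows False
proof -
  have "2 * n / (t + 1) < h + m + e + s - t" using ore d by linarith
  then have "2 * n < (h + m + e + s - t) * (t + 1)" using t by (simp add: divide_less_eq)
  \<comment> \<open>This eliminates \<open>e\<close>, as \<open>e * (t + 1)\<close> is at most
    \<open>n - t - s\<close>.\<close>
  then have "n < (h + m - t - 1) * (t + 1) + t * s + 1"
    using e by (simp add: algebra_simps)
  also have "t * s \<le> t * (g - 1)" using s t by simp
  finally have "n < (h + m - t - 1) * (t + 1) + t * (g - 1) + 1" by simp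
  \<comment> \<open>The factor \<open>m\<close> produces the product \<open>m * g\<close>, which is
    at most \<open>n - h\<close>.\<close>
  then have "n * m < ((h + m - t - 1) * (t + 1) + t * (g - 1) + 1) * m"
    using m t by (intro mult_strict_right_mono) auto
  also have "\<dots> = (h + m - t - 1) * (t + 1) * m + t * (m * g) - t * m + m"
    by (simp add: algebra_simps)
  also have "\<dots> \<le> (h + m - t - 1) * (t + 1) * m + t * (n - h) - t * m + m"
    using mult_left_mono[OF g, of t] t by simp
  finally have "n * (m - t) < (h + m - t - 1) * (t + 1) * m - t * h - t * m + m"
    by (simp add: algebra_simps)
  moreover have "(t + h) * (m + 1) * (m - t) \<le> n * (m - t)"
    using size m t by (intro mult_right_mono) auto
  ultimately have "(t + h) * (m + 1) * (m - t) < (h + m - t - 1) * (t + 1) * m - t * h - t * m + m"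
    by linarith
  \<comment> \<open>The two sides differ by a sum of nonnegative terms, in the direction opposite to
    the strict inequality.\<close>
  moreover have "(t + h) * (m + 1) * (m - t) - ((h + m - t - 1) * (t + 1) * m - t * h - t * m + m)
      = (h - 1) * (m * (m - 2 * t)) + t * (m - 2 * t) + t * m + t * t"
    by (simp add: algebra_simps)
  moreover have "0 \<le> (h - 1) * (m * (m - 2 * t))" "0 \<le> t * (m - 2 * t)" "0 \<le> t * m" "0 \<le> t * t"
    using h m t by simp_all
  ultimately show False by linarith
qed

lemma seg_non_nbr: "a \<in> seg i (gap i - 1) \<Longrightarrow> h \<in> H \<Longrightarrow> \<not> adj a h"
proof -
  assume "a \<in> seg i (gap i - 1)" and h: "h \<in> H"
  then obtain k where k: "a = f k" "i < k" "k \<le> i + (gap i - 1)"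
    unfolding seg_def by force
  then have "0 < k - i" "k - i < gap i" "i + (k - i) = k" by linarith+
  then show "\<not> adj a h" using gap_non_nbr[of "k - i" i h] h k(1) by simp
qed

text \<open>Replacing a shortest segment of the cycle by a path through \<^term>\<open>H\<close> and inserting the
  vertices of the segment again, one by one, would give a larger cycle.\<close>

lemma contradiction:
  assumes tough: "tough_reps t" and t: "1 \<le> t" and ore: "ore (2 * real (card V) / (t + 1) + t - 2)"
  shows False
proof -
  have UH: "U = H" using one_component[OF assms] .
  have m: "2 * t \<le> real (card idx)" using idx_tough[OF tough t] .
  then have m2: "2 \<le> card idx" using t by linarith
  then have "idx \<noteq> {}" by auto
  then obtain i where i: "i \<in> idx" "\<And>j. j \<in> idx \<Longrightarrow> gap i \<le> gap j"
    using ex_has_least_nat[of "\<lambda>i. i \<in> idx" _ gap] by blast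
  let ?S = "seg i (gap i - 1)"
  \<comment> \<open>The detour through \<open>H\<close> is good, and so is every cycle containing
    all vertices of a good one; hence no missing vertex can be inserted into a good cycle that
    misses the fewest vertices.\<close>
  define good where "good c \<longleftrightarrow> cyc c \<and> range f - ?S \<subseteq> set c \<and> H \<inter> set c \<noteq> {}" for c
  have "\<exists>c. good c"
    using detour_rest[OF i(1) gap_less_L[OF i(1) m2]] unfolding good_def by metis
  then obtain c where c: "good c" and c_max: "\<And>c'. good c' \<Longrightarrow> card (V - set c) \<le> card (V - set c')"
    using ex_has_least_nat[of good _ "\<lambda>c. card (V - set c)"] by blast
  have cyc: "cyc c" and Sc: "range f - ?S \<subseteq> set c" and Hc: "H \<inter> set c \<noteq> {}"
    using c by (auto simp: good_def)
  \<comment> \<open>Otherwise \<open>c\<close> would contain the whole optimal cycle and a vertex of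
    \<open>H\<close>.\<close>
  have "\<not> ?S \<subseteq> set c"
    using no_larger_cycle[OF cyc] Sc Hc H_subset by blast
  then obtain y where y: "y \<in> ?S" "y \<notin> set c" by blast
  have yf: "y \<in> range f" using y(1) seg_range by blast
  then have yV: "y \<in> V" using fV by blast
  have max: "\<not> insert y (set c) \<subseteq> set c'" if "cyc c'" for c'
  proof
    assume sub: "insert y (set c) \<subseteq> set c'"
    then have "good c'" using that Sc Hc unfolding good_def by blast
    moreover have "card (V - set c') < card (V - set c)"
      using sub y(2) yV finite_V by (intro psubset_card_mono) auto
    ultimately show False using c_max by (meson leD)
  qed
  have "{w \<in> range f. \<exists>h \<in> H. adj w h} \<subseteq> set c"
    using Sc seg_non_nbr by blast
  then have "card idx \<le> card (set c)"
    unfolding card_idx by (intro card_mono) auto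
  then have tc: "t \<le> real (card (set c))" using m t by linarith
  define e where "e = card {w \<in> set c. adj y w}"
  have ib: "t * (real e + 1) + real e + real (card (V - set c)) \<le> real (card V)"
    using insertion_bound[OF cyc yV y(2) max tough tc] unfolding e_def .
  define s where "s = card (?S - set c)"
  have finS: "finite ?S" by (simp add: seg_def)
  have "?S - set c \<subseteq> V - set c" using seg_range cyc_fun_range[OF f] by blast
  then have "s \<le> card (V - set c)" unfolding s_def using finite_V by (intro card_mono) auto
  then have eb: "t * (real e + 1) + real e + real s \<le> real (card V)" using ib by linarith
  have "card ?S \<le> card {i<..i + (gap i - 1)}" unfolding seg_def by (rule card_image_le) simp
  moreover have "s \<le> card ?S" unfolding s_def using finS by (intro card_mono) auto
  ultimately have sg: "real s + 1 \<le> real (gap i)"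
    using gap_nbr(1)[OF i(1)] by simp
  \<comment> \<open>Since \<open>U = H\<close> and \<open>y\<close> has no neighbour in
    \<open>H\<close>, all its neighbours lie on \<open>c\<close> or among the missing vertices of
    the segment.\<close>
  have "{w. adj y w} \<subseteq> {w \<in> set c. adj y w} \<union> (?S - set c - {y})"
  proof
    fix w assume "w \<in> {w. adj y w}"
    then have w: "adj y w" "w \<in> V" "w \<noteq> y" using nbr_in_V adj_irrefl by auto
    have "w \<notin> U" using seg_non_nbr[OF y(1)] w(1) UH by blast
    then show "w \<in> {w \<in> set c. adj y w} \<union> (?S - set c - {y})" using w Sc by blast
  qed
  then have "deg y \<le> e + card (?S - set c - {y})"
    unfolding deg_def e_def using finS by (intro card_le_Un) auto
  moreover have "card (?S - set c - {y}) + 1 = s"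
    unfolding s_def using y finS by (simp add: card_gt_0_iff card_Suc_Diff1 del: card_Diff_insert)
  ultimately have dy: "real (deg y) + 1 \<le> real e + real s" by linarith
  have dx: "real (deg x) + 1 \<le> real (card H) + real (card idx)"
    using deg_x by linarith
  have "card H = card V - L"
    using cyc_fun_range[OF f] finite_V cyc_fun_card[OF f]
    by (simp add: UH[symmetric] card_Diff_subset finite_subset)
  moreover have "L \<le> card V"
    using card_mono[OF finite_V cyc_fun_range[OF f]] cyc_fun_card[OF f] by simp
  moreover have "card idx * gap i \<le> L" using i(2) by (rule gap_bound)
  ultimately have "real (card idx * gap i) \<le> real (card V) - real (card H)" by linarith
  then have g: "real (card idx) * real (gap i) \<le> real (card V) - real (card H)" by simp
  have "x \<noteq> y" using x yf by blast
  moreover have "\<not> adj x y" using seg_non_nbr[OF y(1) x_in_H] adj_sym by blast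
  ultimately have o: "2 * real (card V) / (t + 1) + t - 2 < real (deg x) + real (deg y)"
    using ore x yV unfolding ore_def by blast
  have "1 \<le> real (card H)" using H_nonempty by simp
  then show False
    using one_component_arith[OF t m _ tough_size[OF tough m2] eb dx dy sg g o] by blast
qed

end

section \<open>Existence of a spanning cycle\<close>

context simple_graph
begin

lemma spanning_cycle_if_tough_1:
  assumes tough: "tough_reps t" and t: "1 \<le> t" and V3: "3 \<le> card V"
    and ore: "ore (2 * real (card V) / (t + 1) + t - 2)"
  shows "\<exists>c. cyc c \<and> set c = V"
proof (rule ccontr)
  assume none: "\<not> ?thesis"
  obtain c where c: "cyc c" and c_min: "\<And>c'. cyc c' \<Longrightarrow> phi (V - set c) \<le> phi (V - set c')"
    using exists_cyc[OF tough t V3] ex_has_least_nat[of cyc _ "\<lambda>c. phi (V - set c)"] by metis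
  obtain f where f: "cyc_fun f (length c)" "range f = set c" using cyc_imp_cyc_fun[OF c] .
  let ?h = "\<lambda>v. card (comp (V - set c) v)"
  have "V - set c \<noteq> {}" using none c cyc_subset_V[OF c] by blast
  then have "\<exists>x. x \<in> V - set c" by blast
  \<comment> \<open>\<open>ex_has_greatest_nat\<close> asks for a strict bound, hence
    \<open>card V + 1\<close>.\<close>
  moreover have "\<forall>v. v \<in> V - set c \<longrightarrow> ?h v < card V + 1"
    using card_mono[OF finite_V] comp_subset by (metis Diff_subset le_imp_less_Suc Suc_eq_plus1 subset_trans)
  ultimately obtain x where x: "x \<in> V - set c" "\<And>v. v \<in> V - set c \<Longrightarrow> ?h v \<le> ?h x"
    using ex_has_greatest_nat[of "\<lambda>v. v \<in> V - set c" _ ?h] by blast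
  interpret optimal_cycle V adj f "length c" x
    using f x c_min by unfold_locales auto
  show False using contradiction[OF tough t ore] .
qed

theorem spanning_cycle:
  assumes tough: "tough_reps t" and t: "0 \<le> t" and V3: "3 \<le> card V"
    and ore: "ore (2 * real (card V) / (t + 1) + t - 2)"
  shows "\<exists>c. cyc c \<and> set c = V"
proof (cases "1 \<le> t")
  case True
  then show ?thesis using spanning_cycle_if_tough_1[OF tough _ V3 ore] by blast
next
  case False
  \<comment> \<open>For \<open>t < 1\<close> the assumed bound is at least
    \<open>card V - 1\<close>; the two sides here differ by
    \<open>(1 - t) * (card V - 1 - t)\<close>.\<close>
  have "(real (card V) + 1 - t) * (t + 1) \<le> 2 * real (card V)"
  proof -
    have "0 \<le> (1 - t) * (real (card V) - 1 - t)" using False V3 t by simp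
    then show ?thesis by (simp add: algebra_simps)
  qed
  then have "real (card V) + 1 - t \<le> 2 * real (card V) / (t + 1)" using t by (simp add: le_divide_eq)
  then have "real (card V) - 1 \<le> 2 * real (card V) / (t + 1) + t - 2" by linarith
  then have o: "ore (real (card V) - 1)" using ore unfolding ore_def by (meson le_less_trans)
  \<comment> \<open>For toughness 1 the required bound is exactly \<open>card V - 1\<close>, so the
    first case applies.\<close>
  then have "ore (2 * real (card V) / (1 + 1) + 1 - 2)" by simp
  then show ?thesis using spanning_cycle_if_tough_1[OF ore_tough_1[OF o] _ V3] by simp
qed

end

section \<open>Hamiltonian graphs\<close>

lemma graph_imp_simple_graph:
  assumes "graph G"
  shows "simple_graph (verts G) (\<lambda>u v. (u, v) \<in> arcs_ends G)"
proof -
  interpret graph G by fact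
  show ?thesis
  proof
    show "(v, u) \<in> arcs_ends G" if "(u, v) \<in> arcs_ends G" for u v
      using arcs_ends_symmetric[OF sym_arcs that] .
    show "(u, u) \<notin> arcs_ends G" for u
      using no_loops by (auto simp: arcs_ends_conv)
    show "u \<in> verts G" if "(u, v) \<in> arcs_ends G" for u v
      using that by (auto simp: arcs_ends_conv)
  qed simp
qed

lemma (in graph) out_degree_conv: "out_degree G u = card {w. (u, w) \<in> arcs_ends G}"
proof -
  have "{w. (u, w) \<in> arcs_ends G} = head G ` out_arcs G u"
    by (auto simp: arcs_ends_conv out_arcs_def)
  moreover have "inj_on (head G) (out_arcs G u)"
    by (rule inj_onI) (auto intro!: no_multi_arcs simp: arc_to_ends_def)
  ultimately show ?thesis by (simp add: out_degree_def card_image)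
qed

text \<open>Pairwise unconnected vertices lie in different components, so \<open>card I\<close> is
  at most the number of components; as \<open>0 \<le> t\<close>, it can replace that number in the
  inequality.\<close>

lemma tough_imp_tough_reps:
  assumes "graph G" "tough t G" "0 \<le> t"
  shows "simple_graph.tough_reps (verts G) (\<lambda>u v. (u, v) \<in> arcs_ends G) t"
proof -
  interpret graph G by fact
  interpret simple_graph "verts G" "\<lambda>u v. (u, v) \<in> arcs_ends G"
    using assms(1) by (rule graph_imp_simple_graph)
  show ?thesis
    unfolding tough_reps_def
  proof (intro allI impI)
    fix U I assume U: "U \<subseteq> verts G" and I: "I \<subseteq> U"
      and sep: "2 \<le> card I \<and> (\<forall>u\<in>I. \<forall>v\<in>I. u \<noteq> v \<longrightarrow> \<not> conn U u v)"
    let ?H = "G \<restriction> U"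
    have ind: "induced_subgraph ?H G" using U by (rule induced_induce)
    interpret H: sym_digraph ?H using ind by (rule induced_graph_imp_graph)
    interpret H: fin_digraph ?H
      using U by unfold_locales (auto intro: finite_subset)
    have conn: "conn U u v" if "u \<rightarrow>\<^sup>*\<^bsub>?H\<^esub> v" for u v
      using that unfolding reachable_def conn_def
      by (rule rtrancl_on_mono[rotated 2]) (auto simp: arcs_ends_conv)
    have "inj_on H.scc_of I"
    proof (rule inj_onI)
      fix u v assume uv: "u \<in> I" "v \<in> I" "H.scc_of u = H.scc_of v"
      then have "v \<in> H.scc_of u" using H.in_scc_of_self[of v] I by auto
      then have "conn U u v" using conn by (auto simp: H.scc_of_def)
      then show "u = v" using sep uv by blast
    qed
    then have "card I = card (H.scc_of ` I)" by (simp add: card_image)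
    also have "\<dots> \<le> card H.sccs_verts"
    proof (intro card_mono H.finite_sccs_verts image_subsetI)
      show "H.scc_of u \<in> H.sccs_verts" if "u \<in> I" for u
        using that I by (intro H.scc_of_in_sccs_verts) auto
    qed
    also have "\<dots> = card (graph_components ?H)"
      unfolding graph_components_eq_sccs[OF H.sym_digraph_axioms] by (rule H.card_sccs_verts)
    finally have c: "card I \<le> card (graph_components ?H)" .
    have "verts G - (verts G - U) = U" using U by blast
    then have "2 \<le> card (graph_components ?H) \<Longrightarrow>
        t * real (card (graph_components ?H)) \<le> real (card (verts G - U))"
      using assms(2)[unfolded tough_def, rule_format, of "verts G - U"] by simp
    then have "t * real (card (graph_components ?H)) \<le> real (card (verts G - U))"
      using c sep by linarith
    moreover have "real (card (verts G - U)) = real (card (verts G)) - real (card U)"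
      using U by (simp add: card_Diff_subset finite_subset card_mono of_nat_diff)
    moreover have "t * real (card I) \<le> t * real (card (graph_components ?H))"
      using c assms(3) by (intro mult_left_mono) simp_all
    ultimately show "t * real (card I) + real (card U) \<le> real (card (verts G))" by linarith
  qed
qed

lemma sigma2_imp_ore:
  assumes "graph G" "sigma2 G > ereal s"
  shows "simple_graph.ore (verts G) (\<lambda>u v. (u, v) \<in> arcs_ends G) s"
proof -
  interpret graph G by fact
  interpret simple_graph "verts G" "\<lambda>u v. (u, v) \<in> arcs_ends G"
    using assms(1) by (rule graph_imp_simple_graph)
  let ?D = "{out_degree G u + out_degree G v | u v.
    u \<in> verts G \<and> v \<in> verts G \<and> u \<noteq> v \<and> (u, v) \<notin> arcs_ends G}"
  show ?thesis
    unfolding ore_def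
  proof (intro ballI impI)
    fix u v assume uv: "u \<in> verts G" "v \<in> verts G" "u \<noteq> v" "(u, v) \<notin> arcs_ends G"
    then have "\<not> complete_digraph (card (verts G)) G" by (auto simp: complete_digraph_def)
    then have "s < real (Min ?D)" using assms(2) by (simp add: sigma2_def)
    also have "?D \<subseteq> (\<lambda>(u, v). out_degree G u + out_degree G v) ` (verts G \<times> verts G)" by auto
    then have "finite ?D" by (rule finite_subset) simp
    then have "Min ?D \<le> out_degree G u + out_degree G v"
      using uv by (intro Min_le) blast+
    finally show "s < real (deg u) + real (deg v)"
      by (simp add: deg_def out_degree_conv)
  qed
qed

lemma spanning_cyc_imp_hamiltonian:
  assumes "graph G" and c: "simple_graph.cyc (\<lambda>u v. (u, v) \<in> arcs_ends G) c" "set c = verts G"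
  shows "hamiltonian G"
proof -
  interpret graph G by fact
  interpret simple_graph "verts G" "\<lambda>u v. (u, v) \<in> arcs_ends G"
    using assms(1) by (rule graph_imp_simple_graph)
  obtain f where f: "cyc_fun f (length c)" "range f = set c" using cyc_imp_cyc_fun[OF c(1)] .
  let ?L = "length c"
  have L: "3 \<le> ?L" using c(1) by (simp add: cyc_def)
  have "\<forall>i. \<exists>a. a \<in> arcs G \<and> tail G a = f i \<and> head G a = f (Suc i)"
    using cyc_fun_adj[OF f(1)] by (fastforce simp: arcs_ends_conv)
  then obtain a where a: "\<And>i. a i \<in> arcs G" "\<And>i. tail G (a i) = f i" "\<And>i. head G (a i) = f (Suc i)"
    by metis
  let ?p = "map a [0..<?L]"
  \<comment> \<open>\<open>cas\<close> and \<open>awalk_verts\<close> recurse on the head of the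
    list, so the index range is unrolled from the left.\<close>
  have upt: "[i..<i + Suc n] = i # [Suc i..<Suc i + n]" for i n
    by (simp add: upt_conv_Cons del: upt_Suc)
  have "cas (f i) (map a [i..<i + n]) (f (i + n))" for i n
  proof (induction n arbitrary: i)
    case (Suc n)
    show ?case unfolding upt using Suc[of "Suc i"] a by simp
  qed simp
  from this[of 0 ?L] have "awalk (f 0) ?p (f 0)"
    using a c(2) f cyc_fun_period[OF f(1), of 0] by (auto simp: awalk_def)
  moreover have "awalk_verts (f 0) ?p = f 0 # map f [1..<1 + ?L]"
  proof -
    have "awalk_verts (f i) (map a [i..<i + n]) = f i # map f [Suc i..<Suc i + n]" for i n
    proof (induction n arbitrary: i)
      case (Suc n)
      show ?case unfolding upt using Suc[of "Suc i"] a by simp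
    qed simp
    from this[of 0 ?L] show ?thesis by simp
  qed
  \<comment> \<open>\<open>tl\<close> drops the start \<open>f 0\<close>, which returns at the end
    as \<open>f ?L\<close>; what remains is a window of length \<open>?L\<close>.\<close>
  then have "distinct (tl (awalk_verts (f 0) ?p))"
    using distinct_map_arc[OF f(1), of "1 + ?L" 1] by simp
  moreover have "tail G ` set ?p = verts G"
    using a(2) cyc_fun_window[OF f(1), of 0] f(2) c(2) by (simp add: image_image)
  ultimately show ?thesis
    unfolding hamiltonian_def cycle_def using L by (intro exI[of _ ?p]) auto
qed

theorem theorem1p1:
  fixes G :: "('a, 'b) pre_digraph" and t :: real
  assumes "graph G"
    and "card (verts G) \<ge> 3"
    and "t \<ge> 0"
    and "tough t G"
    and "sigma2 G > ereal (2 * real (card (verts G)) / (t + 1) + t - 2)"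
  shows "hamiltonian G"
proof -
  interpret simple_graph "verts G" "\<lambda>u v. (u, v) \<in> arcs_ends G"
    using assms(1) by (rule graph_imp_simple_graph)
  obtain c where "cyc c" "set c = verts G"
    using spanning_cycle[OF tough_imp_tough_reps[OF assms(1,4,3)] assms(3,2) sigma2_imp_ore[OF assms(1,5)]]
    by blast
  then show ?thesis by (rule spanning_cyc_imp_hamiltonian[OF assms(1)])
qed

end
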